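(* Let $\varphi_L$ be a geometric Lorenz flow associated with a geometric Lorenz vector field $X_L$ controlled by a Lorenz map $L:\Sigma\setminus\Gamma\to\Sigma$, with trapping region $T_L$ (all as defined in the context). Then there exists a residual subset $\mathcal{H}$ of $\Sigma$ such that, for any $\boldsymbol{x}\in \mathcal{H}$, the forward orbit $\varphi_L(\boldsymbol{x},t)_{t\geq 0}$ has historic behavior, i.e. there exists a continuous function $g:T_L\to\mathbb{R}$ for which the limit $$\lim_{t\to\infty}\frac1{t}\int_0^t g(\varphi_L(\boldsymbol{x},s))\,ds$$ does not exist.
   Context: Square and Lorenz map. Let $\Sigma=\{(x,y)\in\mathbb{R}^2 : |x|,|y|\leq 1\}$ and $\Gamma=\{(0,y)\in\mathbb{R}^2 : |y|\leq 1\}$. Let $\Sigma_\pm$ be the components of $\Sigma\setminus\Gamma$ with $(\pm1,0)\in\Sigma_\pm$. A map $L:\Sigma\setminus\Gamma\to\Sigma$ is a Lorenz map if it is a piecewise $C^2$ diffeomorphism of the form $L(x,y)=(\alpha(x),\beta(x,y))$, where: - $\alpha:[-1,1]\setminus\{0\}\to[-1,1]$ is a piecewise $C^2$ function with $\alpha(-x)=-\alpha(x)$, $\lim_{x\to0+}\alpha(x)=-1$, $\alpha(1)<1$, $\lim_{x\to0+}\alpha'(x)=\infty$, and $\alpha'(x)>\sqrt2$ for any $x\in(0,1]$; - $\beta:\Sigma\setminus\Gamma\to[-1,1]$ is a contraction in the $y$-direction; - the images $L(\Sigma_+)$, $L(\Sigma_-)$ are mutually disjoint cusps in $\Sigma$,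 whose vertices $\boldsymbol{v}_+$, $\boldsymbol{v}_-$ are contained in $\{-1\}\times[-1,1]$ and $\{1\}\times[-1,1]$ respectively. The square $\Sigma$ and its subsets are identified with their images in $\mathbb{R}^3$ under $(x,y)\mapsto(x,y,1)$. Geometric Lorenz vector field and flow. A $C^2$ vector field $X_L$ on $\mathbb{R}^3$ is a geometric Lorenz vector field controlled by $L$ if: (i) on a neighborhood of the origin $\mathbf{0}$ of $\mathbb{R}^3$, $X_L$ is given by $$\dot x=\lambda x,\quad \dot y=-\mu y,\quad \dot z=-\nu z$$ for some $\lambda>0$, $\mu>\nu>0$; moreover $\Gamma$ is contained in the stable manifold $W^s(\mathbf{0})$ of $\mathbf{0}$; (ii) all forward orbits of $X_L$ starting from $\Sigma\setminus\Gamma$ return to $\Sigma$, and the first return map is $L$. The geometric Lorenz flow associated with $X_L$ is the $C^2$ map $\varphi_L:\mathbb{R}^3\times\mathbb{R}\to\mathbb{R}^3$ with $\varphi_L(\boldsymbol{x},0)=\boldsymbol{x}$ and $(\partial/\partial t)\varphi_L(\boldsymbol{x},t)=X_L(\varphi_L(\boldsymbol{x},t))$. The trapping region $T_L$ is the closure in $\mathbb{R}^3$ of $\bigcup_{\boldsymbol{z}\in\Sigma\setminus\Gamma}\varphi_L(\boldsymbol{z},[0,\infty))$; it is homeomorphic to a genus two handlebody, and any forward orbit with initial point in $T_L$ stays in $T_L$. Standing assumption: the flow satisfies the linear differential equation in (i) on $V_L=T_L\cap([-0.1,0.1]\times[-1,1]\times[0,1])$. A subset of $\Sigma$ is residual if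 it contains a countable intersection of open dense subsets of $\Sigma$. *)

theory Defs
  imports "HOL-Analysis.Analysis"
begin

type_synonym R2 = "real \<times> real"
type_synonym R3 = "real \<times> real \<times> real"

section \<open>Maps of class $C^2$\<close>

text \<open>
  On a set that need not be open, a map is of class C^2 if it is the restriction of a C^2 map
  defined on an open neighbourhood of the set; for open S this is the usual notion.
\<close>

definition C2_on :: "'a::real_normed_vector set \<Rightarrow> ('a \<Rightarrow> 'b::real_normed_vector) \<Rightarrow> bool" where
  "C2_on S f \<longleftrightarrow>
     (\<exists>U F (F' :: 'a \<Rightarrow> 'a \<Rightarrow>\<^sub>L 'b) (F'' :: 'a \<Rightarrow> 'a \<Rightarrow>\<^sub>L 'a \<Rightarrow>\<^sub>L 'b).
        open U \<and> S \<subseteq> U \<and> (\<forall>p\<in>S. F p = f p) \<and>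
        (\<forall>p\<in>U. (F has_derivative blinfun_apply (F' p)) (at p)) \<and>
        (\<forall>p\<in>U. (F' has_derivative blinfun_apply (F'' p)) (at p)) \<and>
        continuous_on U F'')"

definition C2_diffeo_on :: "'a::real_normed_vector set \<Rightarrow> ('a \<Rightarrow> 'b::real_normed_vector) \<Rightarrow> bool" where
  "C2_diffeo_on S f \<longleftrightarrow> inj_on f S \<and> C2_on S f \<and> C2_on (f ` S) (inv_into S f)"

section \<open>Lorenz maps\<close>

definition Sigma_sq :: "R2 set" where
  "Sigma_sq = {(x, y). \<bar>x\<bar> \<le> 1 \<and> \<bar>y\<bar> \<le> 1}"

definition Gamma_seg :: "R2 set" where
  "Gamma_seg = {(x, y). x = 0 \<and> \<bar>y\<bar> \<le> 1}"

definition Sigma_plus :: "R2 set" where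
  "Sigma_plus = connected_component_set (Sigma_sq - Gamma_seg) (1, 0)"

definition Sigma_minus :: "R2 set" where
  "Sigma_minus = connected_component_set (Sigma_sq - Gamma_seg) (-1, 0)"

text \<open>
  The vertex v is not a point of the cusp C. Adding it gives a closed topological disc that has v
  on its boundary and a single one-sided tangent direction u at v, so that the two sides of C
  enclose angle zero at v. Note that \<open>sgn (p - v)\<close> is the unit vector from v to p.
\<close>

definition cusp_with_vertex :: "R2 set \<Rightarrow> R2 \<Rightarrow> bool" where
  "cusp_with_vertex C v \<longleftrightarrow>
     v \<notin> C \<and> insert v C homeomorphic cball (0 :: R2) 1 \<and> v \<in> frontier (insert v C) \<and>
     (\<exists>u. ((\<lambda>p. sgn (p - v)) \<longlongrightarrow> u) (at v within C))"

text \<open>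
  Functions on the slit square or the punctured interval are total functions of which only the
  values on these domains matter. The derivative of \<open>\<alpha>\<close> at 1 is one-sided.
\<close>

definition Lorenz_map :: "(R2 \<Rightarrow> R2) \<Rightarrow> bool" where
  "Lorenz_map L \<longleftrightarrow>
     L ` (Sigma_sq - Gamma_seg) \<subseteq> Sigma_sq \<and>
     C2_diffeo_on Sigma_plus L \<and> C2_diffeo_on Sigma_minus L \<and>
     (\<exists>(\<alpha> :: real \<Rightarrow> real) (\<beta> :: R2 \<Rightarrow> real).
        (\<forall>(x, y) \<in> Sigma_sq - Gamma_seg. L (x, y) = (\<alpha> x, \<beta> (x, y))) \<and>
        \<alpha> ` ({-1..1} - {0}) \<subseteq> {-1..1} \<and>
        C2_on {0<..1} \<alpha> \<and> C2_on {-1..<0} \<alpha> \<and>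
        (\<forall>x \<in> {-1..1} - {0}. \<alpha> (- x) = - \<alpha> x) \<and>
        (\<alpha> \<longlongrightarrow> -1) (at_right 0) \<and>
        \<alpha> 1 < 1 \<and>
        (\<exists>\<alpha>'. (\<forall>x\<in>{0<..1}. (\<alpha> has_real_derivative \<alpha>' x) (at x within {0<..1}) \<and> \<alpha>' x > sqrt 2) \<and>
              filterlim \<alpha>' at_top (at_right 0)) \<and>
        \<beta> ` (Sigma_sq - Gamma_seg) \<subseteq> {-1..1} \<and>
        (\<exists>c<1. \<forall>x \<in> {-1..1} - {0}. c-lipschitz_on {-1..1} (\<lambda>y. \<beta> (x, y)))) \<and>
     L ` Sigma_plus \<inter> L ` Sigma_minus = {} \<and>
     (\<exists>v \<in> {-1} \<times> {-1..1}. cusp_with_vertex (L ` Sigma_plus) v) \<and>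
     (\<exists>v \<in> {1} \<times> {-1..1}. cusp_with_vertex (L ` Sigma_minus) v)"

section \<open>Geometric Lorenz vector fields and flows\<close>

definition emb :: "R2 \<Rightarrow> R3" where
  "emb = (\<lambda>(x, y). (x, y, 1))"

definition is_C2_flow :: "(R3 \<Rightarrow> R3) \<Rightarrow> (R3 \<times> real \<Rightarrow> R3) \<Rightarrow> bool" where
  "is_C2_flow X \<phi> \<longleftrightarrow>
     C2_on UNIV \<phi> \<and>
     (\<forall>p. \<phi> (p, 0) = p) \<and>
     (\<forall>p t. ((\<lambda>s. \<phi> (p, s)) has_vector_derivative X (\<phi> (p, t))) (at t))"

definition saddle_field :: "real \<Rightarrow> real \<Rightarrow> real \<Rightarrow> R3 \<Rightarrow> R3" where
  "saddle_field lam mu nu = (\<lambda>(x, y, z). (lam * x, - mu * y, - nu * z))"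

definition stable_manifold :: "(R3 \<times> real \<Rightarrow> R3) \<Rightarrow> R3 \<Rightarrow> R3 set" where
  "stable_manifold \<phi> q = {p. ((\<lambda>t. \<phi> (p, t)) \<longlongrightarrow> q) at_top}"

definition first_return :: "(R3 \<times> real \<Rightarrow> R3) \<Rightarrow> R3 set \<Rightarrow> R3 \<Rightarrow> R3 \<Rightarrow> bool" where
  "first_return \<phi> S p q \<longleftrightarrow>
     (\<exists>\<tau>>0. \<phi> (p, \<tau>) = q \<and> q \<in> S \<and> (\<forall>t\<in>{0<..<\<tau>}. \<phi> (p, t) \<notin> S))"

text \<open>
  X is a geometric Lorenz vector field controlled by L, with eigenvalues \<open>lam\<close>, \<open>-mu\<close>, \<open>-nu\<close>
  at the origin. Its orbits are described by its flow \<open>\<phi>\<close>, which X determines uniquely.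
\<close>

definition geometric_Lorenz_field ::
  "(R2 \<Rightarrow> R2) \<Rightarrow> real \<Rightarrow> real \<Rightarrow> real \<Rightarrow> (R3 \<Rightarrow> R3) \<Rightarrow> (R3 \<times> real \<Rightarrow> R3) \<Rightarrow> bool" where
  "geometric_Lorenz_field L lam mu nu X \<phi> \<longleftrightarrow>
     C2_on UNIV X \<and> is_C2_flow X \<phi> \<and>
     lam > 0 \<and> mu > nu \<and> nu > 0 \<and>
     (\<exists>U. open U \<and> 0 \<in> U \<and> (\<forall>p\<in>U. X p = saddle_field lam mu nu p)) \<and>
     emb ` Gamma_seg \<subseteq> stable_manifold \<phi> 0 \<and>
     (\<forall>p \<in> Sigma_sq - Gamma_seg. first_return \<phi> (emb ` Sigma_sq) (emb p) (emb (L p)))"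

definition trapping_region :: "(R3 \<times> real \<Rightarrow> R3) \<Rightarrow> R3 set" where
  "trapping_region \<phi> = closure (\<Union>p \<in> Sigma_sq - Gamma_seg. (\<lambda>t. \<phi> (emb p, t)) ` {0..})"

definition V_region :: "(R3 \<times> real \<Rightarrow> R3) \<Rightarrow> R3 set" where
  "V_region \<phi> = trapping_region \<phi> \<inter> ({-0.1..0.1} \<times> {-1..1} \<times> {0..1})"

section \<open>Residual sets and historic behavior\<close>

definition residual_in :: "'a::topological_space set \<Rightarrow> 'a set \<Rightarrow> bool" where
  "residual_in S H \<longleftrightarrow>
     H \<subseteq> S \<and>
     (\<exists>\<G>. countable \<G> \<and>
          (\<forall>G\<in>\<G>. openin (top_of_set S) G \<and> S \<subseteq> closure G) \<and>
          S \<inter> \<Inter>\<G> \<subseteq> H)"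

definition historic_behavior :: "(R3 \<times> real \<Rightarrow> R3) \<Rightarrow> R3 set \<Rightarrow> R3 \<Rightarrow> bool" where
  "historic_behavior \<phi> T p \<longleftrightarrow>
     (\<exists>g :: R3 \<Rightarrow> real. continuous_on T g \<and>
        (\<nexists>l. ((\<lambda>t. 1 / t * integral {0..t} (\<lambda>s. g (\<phi> (p, s)))) \<longlongrightarrow> l) at_top))"

end

theory Submission
  imports Defs
begin

text \<open>
  Let \<open>g\<close> be a continuous bump with \<open>g 0 = 1\<close>. Since \<open>\<alpha>\<close> expands by more than \<open>sqrt 2\<close>, every point of
  \<open>(-1, 1)\<close> has a dense backward orbit under \<open>\<alpha>\<close>. Hence a dense set of points of the square
  flows into \<open>\<Gamma>\<close>, then to the origin, and has time average 1 for \<open>g\<close>. Likewise a dense set of points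
  flows into the vertical fibre through a fixed periodic point of \<open>L\<close>; as \<open>L\<close> contracts fibres, these orbits
  end up close to a periodic orbit of the flow, which stays away from the origin, so \<open>g\<close> is eventually
  small along them if its support is small. Finite-time averages are continuous in the initial point, so for
  generic points the averages of \<open>g\<close> are infinitely often above \<open>2/3\<close> and infinitely often below \<open>1/3\<close>.

  The delicate point is that the return time must be bounded near the periodic orbit. The
  argument for this needs the periodic points of \<open>L\<close> to be interior to the square, where the orbits of
  period 2 may fail to be; in that case an orbit of period 4 is interior.
\<close>

section \<open>Flows of $C^2$ vector fields\<close>

text \<open>Gronwall's argument: on a ball containing both curves up to time \<open>t\<close> the
  field has a Lipschitz constant \<open>K\<close>, so exp (-2Ks) times the squared distance of the
  curves is nonincreasing in s and starts at 0.\<close>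

lemma ode_unique_nonneg:
  fixes X :: "'a::euclidean_space \<Rightarrow> 'a"
  assumes lip: "\<And>R. \<exists>K. \<forall>p\<in>cball 0 R. \<forall>q\<in>cball 0 R. norm (X p - X q) \<le> K * norm (p - q)"
    and u: "\<And>t. (u has_vector_derivative X (u t)) (at t)"
    and v: "\<And>t. (v has_vector_derivative X (v t)) (at t)"
    and init: "u 0 = v 0" and "0 \<le> t"
  shows "u t = v t"
proof -
  have cont: "continuous_on {0..t} u" "continuous_on {0..t} v"
    using u v by (auto intro!: continuous_at_imp_continuous_on has_vector_derivative_continuous)
  then have "bounded (u ` {0..t} \<union> v ` {0..t})"
    by (intro compact_imp_bounded compact_Un compact_continuous_image compact_Icc)
  then obtain R where R: "\<And>s. s \<in> {0..t} \<Longrightarrow> u s \<in> cball 0 R \<and> v s \<in> cball 0 R"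
    unfolding bounded_iff by (metis Un_iff image_eqI mem_cball_0)
  obtain K where K: "\<And>p q. p \<in> cball 0 R \<Longrightarrow> q \<in> cball 0 R \<Longrightarrow> norm (X p - X q) \<le> K * norm (p - q)"
    using lip by meson
  define f where "f s = exp (- (2 * K) * s) * ((u s - v s) \<bullet> (u s - v s))" for s
  define f' where "f' s = exp (- (2 * K) * s) *
    (2 * ((u s - v s) \<bullet> (X (u s) - X (v s))) - 2 * K * ((u s - v s) \<bullet> (u s - v s)))" for s
  have der: "(f has_real_derivative f' s) (at s)" for s
  proof -
    have d: "((\<lambda>s. u s - v s) has_derivative (\<lambda>h. h *\<^sub>R (X (u s) - X (v s)))) (at s)"
      using has_vector_derivative_diff[OF u v] unfolding has_vector_derivative_def .
    have "((\<lambda>s. (u s - v s) \<bullet> (u s - v s)) has_derivative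
       (\<lambda>h. h * (2 * ((u s - v s) \<bullet> (X (u s) - X (v s)))))) (at s)"
      by (rule has_derivative_eq_rhs[OF has_derivative_inner[OF d d]])
        (auto simp: inner_commute algebra_simps)
    then have "((\<lambda>s. (u s - v s) \<bullet> (u s - v s)) has_real_derivative
        2 * ((u s - v s) \<bullet> (X (u s) - X (v s)))) (at s)"
      by (simp add: has_field_derivative_def mult.commute[of _ "2 * _"])
    moreover have "((\<lambda>s. exp (- (2 * K) * s)) has_real_derivative - (2 * K) * exp (- (2 * K) * s)) (at s)"
      by (auto intro!: derivative_eq_intros)
    ultimately show ?thesis unfolding f_def f'_def
      by (rule DERIV_cong[OF DERIV_mult[rotated]]) (simp add: algebra_simps)
  qed
  have "f t \<le> f 0"
  proof (rule DERIV_nonpos_imp_nonincreasing[OF \<open>0 \<le> t\<close>])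
    fix s assume s: "0 \<le> s" "s \<le> t"
    have "(u s - v s) \<bullet> (X (u s) - X (v s)) \<le> norm (u s - v s) * norm (X (u s) - X (v s))"
      by (rule norm_cauchy_schwarz)
    also have "\<dots> \<le> norm (u s - v s) * (K * norm (u s - v s))"
      using R s by (intro mult_left_mono K) auto
    also have "\<dots> = K * ((u s - v s) \<bullet> (u s - v s))"
      by (simp add: power2_norm_eq_inner[symmetric] power2_eq_square)
    finally have "f' s \<le> 0"
      unfolding f'_def by (intro mult_nonneg_nonpos) auto
    then show "\<exists>y. (f has_real_derivative y) (at s) \<and> y \<le> 0" using der by blast
  qed
  then have "(u t - v t) \<bullet> (u t - v t) \<le> 0"
    using init by (simp add: f_def mult_le_0_iff)
  then show ?thesis
    by (metis inner_ge_zero inner_eq_zero_iff order_antisym right_minus_eq)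
qed

text \<open>Negative times reduce to positive ones because the time-reversed curves solve the
  equation of the field \<open>- X\<close>.\<close>

lemma ode_unique:
  fixes X :: "'a::euclidean_space \<Rightarrow> 'a"
  assumes lip: "\<And>R. \<exists>K. \<forall>p\<in>cball 0 R. \<forall>q\<in>cball 0 R. norm (X p - X q) \<le> K * norm (p - q)"
    and u: "\<And>t. (u has_vector_derivative X (u t)) (at t)"
    and v: "\<And>t. (v has_vector_derivative X (v t)) (at t)"
    and init: "u 0 = v 0"
  shows "u t = v t"
proof (cases "0 \<le> t")
  case True
  then show ?thesis using ode_unique_nonneg[OF lip u v init] by blast
next
  case False
  have rev: "((\<lambda>t. w (- t)) has_vector_derivative - X (w (- t))) (at t)"
    if "\<And>t. (w has_vector_derivative X (w t)) (at t)" for w t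
  proof -
    have "(w \<circ> uminus has_vector_derivative (- 1) *\<^sub>R X (w (- t))) (at t)"
      by (rule vector_diff_chain_at) (auto intro!: derivative_eq_intros that)
    then show ?thesis by (simp add: o_def)
  qed
  have "u (- (- t)) = v (- (- t))"
  proof (rule ode_unique_nonneg[where X = "\<lambda>p. - X p" and u = "\<lambda>t. u (- t)" and v = "\<lambda>t. v (- t)"])
    show "\<exists>K. \<forall>p\<in>cball 0 R. \<forall>q\<in>cball 0 R. norm (- X p - - X q) \<le> K * norm (p - q)" for R
      using lip[of R] by (simp add: norm_minus_commute)
  qed (use rev u v init False in auto)
  then show ?thesis by simp
qed

lemma C2_on_imp_continuous_on: "C2_on S f \<Longrightarrow> continuous_on S f"
  unfolding C2_on_def
  by (smt (verit, best) continuous_at_imp_continuous_on continuous_on_cong has_derivative_continuous subsetD)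

text \<open>The first derivative is itself differentiable, hence continuous and bounded on the
  compact ball; by convexity of the ball this bound is a Lipschitz constant.\<close>

lemma C2_on_UNIV_imp_lipschitz_cball:
  fixes X :: "'a::euclidean_space \<Rightarrow> 'b::real_normed_vector"
  assumes "C2_on UNIV X"
  shows "\<exists>K. \<forall>p\<in>cball 0 R. \<forall>q\<in>cball 0 R. norm (X p - X q) \<le> K * norm (p - q)"
proof -
  obtain F and F' :: "'a \<Rightarrow> 'a \<Rightarrow>\<^sub>L 'b" and F'' :: "'a \<Rightarrow> 'a \<Rightarrow>\<^sub>L 'a \<Rightarrow>\<^sub>L 'b" where
    "\<forall>p. F p = X p" and F: "\<And>p. (F has_derivative blinfun_apply (F' p)) (at p)"
    and F': "\<And>p. (F' has_derivative blinfun_apply (F'' p)) (at p)"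
    using assms unfolding C2_on_def by (metis UNIV_I subsetD)
  then have "F = X" by auto
  have "continuous_on (cball 0 R) F'"
    using F' by (auto intro!: continuous_at_imp_continuous_on has_derivative_continuous)
  then have "bounded (F' ` cball 0 R)"
    by (intro compact_imp_bounded compact_continuous_image) auto
  then obtain K where K: "\<And>p. p \<in> cball 0 R \<Longrightarrow> norm (F' p) \<le> K"
    unfolding bounded_iff by (metis image_eqI)
  have "norm (X p - X q) \<le> K * norm (p - q)" if "p \<in> cball 0 R" "q \<in> cball 0 R" for p q
  proof (rule differentiable_bound[of "cball 0 R" X "\<lambda>p. blinfun_apply (F' p)"])
    show "(X has_derivative blinfun_apply (F' x)) (at x within cball 0 R)" for x
      using F \<open>F = X\<close> by (blast intro: has_derivative_at_withinI)
    show "onorm (blinfun_apply (F' x)) \<le> K" if "x \<in> cball 0 R" for x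
      using K[OF that] by (simp add: norm_blinfun.rep_eq)
  qed (use that in auto)
  then show ?thesis by blast
qed

lemma is_C2_flowD:
  assumes "is_C2_flow X \<phi>"
  shows "continuous_on UNIV \<phi>" "\<phi> (p, 0) = p"
    "((\<lambda>s. \<phi> (p, s)) has_vector_derivative X (\<phi> (p, t))) (at t)"
  using assms C2_on_imp_continuous_on unfolding is_C2_flow_def by blast+

text \<open>As functions of \<open>t\<close>, both sides solve the same equation with the same value
  at 0.\<close>

lemma C2_flow_add:
  assumes "C2_on UNIV X" and "is_C2_flow X \<phi>"
  shows "\<phi> (\<phi> (p, s), t) = \<phi> (p, s + t)"
proof (rule ode_unique[where X = X and u = "\<lambda>t. \<phi> (\<phi> (p, s), t)" and v = "\<lambda>t. \<phi> (p, s + t)"])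
  note d = is_C2_flowD(3)[OF assms(2)]
  show "((\<lambda>t. \<phi> (\<phi> (p, s), t)) has_vector_derivative X (\<phi> (\<phi> (p, s), t))) (at t)" for t
    by (rule d)
  have "((\<lambda>t. \<phi> (p, t)) \<circ> (+) s has_vector_derivative 1 *\<^sub>R X (\<phi> (p, s + t))) (at t)" for t
    by (rule vector_diff_chain_at[OF _ d]) (auto intro!: derivative_eq_intros)
  then show "((\<lambda>t. \<phi> (p, s + t)) has_vector_derivative X (\<phi> (p, s + t))) (at t)" for t
    by (simp add: o_def)
  show "\<phi> (\<phi> (p, s), 0) = \<phi> (p, s + 0)"
    by (simp add: is_C2_flowD(2)[OF assms(2)])
qed (rule C2_on_UNIV_imp_lipschitz_cball[OF assms(1)])

lemma C2_flow_fixed_point: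
  assumes "C2_on UNIV X" and "is_C2_flow X \<phi>" and "X q = 0"
  shows "\<phi> (q, t) = q"
  by (rule ode_unique[where X = X and u = "\<lambda>t. \<phi> (q, t)" and v = "\<lambda>t. q"])
    (simp_all add: C2_on_UNIV_imp_lipschitz_cball[OF assms(1)] is_C2_flowD[OF assms(2)] assms(3))

section \<open>The interval map\<close>

text \<open>The derivative condition takes the form of a uniform lower bound on increments over (0,
  1], which survives the limit to the endpoint 0; oddness transfers it to the left branch.\<close>

locale lorenz_interval_map =
  fixes \<alpha> :: "real \<Rightarrow> real" and \<kappa> :: real
  assumes odd: "x \<in> {-1..1} - {0} \<Longrightarrow> \<alpha> (- x) = - \<alpha> x"
    and expand: "0 < x \<Longrightarrow> x < y \<Longrightarrow> y \<le> 1 \<Longrightarrow> \<kappa> * (y - x) \<le> \<alpha> y - \<alpha> x"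
    and kappa: "sqrt 2 < \<kappa>"
    and lim0: "(\<alpha> \<longlongrightarrow> -1) (at_right 0)"
    and cont: "continuous_on {0<..1} \<alpha>"
    and at_1: "\<alpha> 1 < 1"
begin

text \<open>The continuous extension of the right branch to 0.\<close>

definition branch :: "real \<Rightarrow> real" where
  "branch x = (if x = 0 then -1 else \<alpha> x)"

lemma branch_0 [simp]: "branch 0 = -1"
  and branch_nonzero: "x \<noteq> 0 \<Longrightarrow> branch x = \<alpha> x"
  by (auto simp: branch_def)

lemma kappa_gt_1: "1 < \<kappa>"
  using kappa real_sqrt_gt_1_iff[of 2] by linarith

lemma branch_expand:
  assumes "0 \<le> x" "x \<le> y" "y \<le> 1"
  shows "\<kappa> * (y - x) \<le> branch y - branch x"
proof -
  consider "x = y" | "0 < x" "x < y" | "x = 0" "0 < y" using assms by linarith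
  then show ?thesis
  proof cases
    case 2
    then show ?thesis using expand[of x y] assms by (simp add: branch_def)
  next
    case 3
    \<comment> \<open>The left endpoint \<open>e\<close> tends to 0 in the expansion bound between
      \<open>e\<close> and \<open>y\<close>.\<close>
    have "\<kappa> * (y - 0) \<le> \<alpha> y - (-1)"
    proof (rule tendsto_le)
      show "((\<lambda>e. \<alpha> y - \<alpha> e) \<longlongrightarrow> \<alpha> y - (-1)) (at_right 0)"
        by (intro tendsto_intros lim0)
      show "((\<lambda>e. \<kappa> * (y - e)) \<longlongrightarrow> \<kappa> * (y - 0)) (at_right 0)"
        by (intro tendsto_intros)
      show "\<forall>\<^sub>F e in at_right 0. \<kappa> * (y - e) \<le> \<alpha> y - \<alpha> e"
        using eventually_at_right_less[of 0] eventually_at_rightI[of 0 y "\<lambda>e. e < y"] 3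
        by (auto intro: expand[OF _ _ assms(3)] elim!: eventually_elim2)
    qed simp
    then show ?thesis using 3 by (simp add: branch_def)
  qed simp
qed

lemma branch_strict_mono:
  assumes "0 \<le> x" "x < y" "y \<le> 1"
  shows "branch x < branch y"
proof -
  have "0 < \<kappa> * (y - x)" using assms kappa_gt_1 by (intro mult_pos_pos) auto
  then show ?thesis using branch_expand[of x y] assms by linarith
qed

lemma branch_mono: "0 \<le> x \<Longrightarrow> x \<le> y \<Longrightarrow> y \<le> 1 \<Longrightarrow> branch x \<le> branch y"
  using branch_strict_mono[of x y] by (cases "x = y") auto

lemma continuous_on_branch: "continuous_on {0..1} branch"
proof -
  have "continuous (at x within {0..1}) branch" if "x \<in> {0..1}" for x
  proof (cases "x = 0")
    case True
    have "(branch \<longlongrightarrow> -1) (at_right 0)"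
      using lim0 by (rule tendsto_cong[THEN iffD1, rotated])
        (auto simp: branch_def eventually_at_filter)
    then have "(branch \<longlongrightarrow> -1) (at 0 within {0..1})"
      by (simp add: at_within_Icc_at_right)
    then show ?thesis using True by (simp add: continuous_within)
  next
    case False
    have "continuous_on {0<..1} branch"
      using cont by (rule continuous_on_cong[THEN iffD1, rotated 2]) (auto simp: branch_def)
    then have "continuous (at x within {0<..1}) branch"
      using False that by (auto simp: continuous_on_eq_continuous_within)
    moreover have "at x within {0<..1} = at x within {0..1}"
      by (rule at_within_nhd[of x "{0<..}"]) (use False that in auto)
    ultimately show ?thesis by (simp add: continuous_within)
  qed
  then show ?thesis by (simp add: continuous_on_eq_continuous_within)
qed

lemma branch_IVT:
  assumes "0 \<le> a" "a \<le> b" "b \<le> 1" "branch a \<le> y" "y \<le> branch b"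
  obtains x where "a \<le> x" "x \<le> b" "branch x = y"
  using IVT'[of branch a y b] assms continuous_on_subset[OF continuous_on_branch, of "{a..b}"] by auto

lemma at_1_bounds: "sqrt 2 - 1 \<le> \<alpha> 1" "0 < \<alpha> 1"
proof -
  show "sqrt 2 - 1 \<le> \<alpha> 1" using branch_expand[of 0 1] kappa by (simp add: branch_def)
  moreover have "1 < sqrt 2" by simp
  ultimately show "0 < \<alpha> 1" by linarith
qed

lemma odd_neg: "x \<in> {-1..1} - {0} \<Longrightarrow> \<alpha> x = - \<alpha> (- x)"
  using odd[of "- x"] by simp

lemma alpha_pos_bounds:
  assumes "0 < x" "x \<le> 1"
  shows "-1 < \<alpha> x" "\<alpha> x \<le> \<alpha> 1"
  using branch_strict_mono[of 0 x] branch_strict_mono[of x 1] assms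
  by (cases "x = 1"; simp add: branch_def)+

text \<open>Expansion between \<open>x\<close> and 1 gives
  \<open>\<alpha> 1 - \<alpha> x >= 1 - x\<close>, and \<open>\<alpha> 1 < 1\<close> then forces
  \<open>\<alpha> x < x\<close> for positive \<open>x\<close>. Consequently \<open>L\<close> moves
  every point, which keeps return times away from 0 locally.\<close>

lemma alpha_no_fixed_point: "x \<in> {-1..1} - {0} \<Longrightarrow> \<alpha> x \<noteq> x"
proof -
  have pos: "\<alpha> x < x" if "0 < x" "x \<le> 1" for x
  proof -
    have "1 * (1 - x) \<le> \<kappa> * (1 - x)" using kappa_gt_1 that by (intro mult_right_mono) auto
    then show ?thesis using branch_expand[of x 1] that at_1 by (auto simp: branch_def)
  qed
  assume "x \<in> {-1..1} - {0}"
  then consider "0 < x" "x \<le> 1" | "0 < - x" "- x \<le> 1" by force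
  then show ?thesis
  proof cases
    case 2
    then show ?thesis using pos[of "- x"] odd_neg[OF \<open>x \<in> _\<close>] by linarith
  qed (use pos[of x] in simp)
qed

section \<open>Density of backward orbits of the interval map\<close>

definition reaches :: "real \<Rightarrow> real \<Rightarrow> bool" where
  "reaches = (\<lambda>u v. u \<in> {-1..1} - {0} \<and> v = \<alpha> u)\<^sup>*\<^sup>*"

lemma reaches_refl: "reaches x x"
  by (simp add: reaches_def)

lemma reaches_step: "x \<in> {-1..1} - {0} \<Longrightarrow> reaches (\<alpha> x) z \<Longrightarrow> reaches x z"
  unfolding reaches_def by (rule converse_rtranclp_into_rtranclp[where b = "\<alpha> x"]) simp_all

lemma reaches_uminus: "reaches x z \<Longrightarrow> reaches (- x) (- z)"
  unfolding reaches_def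
proof (induction rule: rtranclp_induct)
  case (step y z)
  then have "- y \<in> {-1..1} - {0} \<and> - z = \<alpha> (- y)" using odd[of y] by simp
  then show ?case by (rule rtranclp.rtrancl_into_rtrancl[OF step.IH])
qed simp

text \<open>A counterexample to the density of the backward orbit of \<open>z\<close>. Such
  intervals are pushed forward until they are too long to fit into [-1, 1].\<close>

definition avoids :: "real \<Rightarrow> real \<Rightarrow> real \<Rightarrow> bool" where
  "avoids z a b \<longleftrightarrow> (\<forall>x\<in>{a<..<b}. \<not> reaches x z)"

lemma avoids_uminus: "avoids z a b \<Longrightarrow> avoids (- z) (- b) (- a)"
  unfolding avoids_def using reaches_uminus[of _ "- z"] by fastforce

lemma avoids_subset: "avoids z a b \<Longrightarrow> a \<le> a' \<Longrightarrow> b' \<le> b \<Longrightarrow> avoids z a' b'"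
  by (auto simp: avoids_def)

lemma avoids_not_mem: "avoids z a b \<Longrightarrow> z \<notin> {a<..<b}"
  using reaches_refl[of z] by (auto simp: avoids_def)

text \<open>If a point of the image reached \<open>z\<close>, then so would its preimage in the open
  interval, one step earlier; that preimage exceeds \<open>a >= 0\<close>, so it is in the domain of
  \<open>\<alpha>\<close>.\<close>

lemma avoids_branch:
  assumes "avoids z a b" "0 \<le> a" "a < b" "b \<le> 1"
  shows "avoids z (branch a) (branch b)"
  unfolding avoids_def
proof safe
  fix y assume y: "y \<in> {branch a<..<branch b}" "reaches y z"
  obtain x where x: "a \<le> x" "x \<le> b" "branch x = y"
    using branch_IVT[of a b y] assms y by auto
  with y assms have "x \<in> {a<..<b}"
    by (metis greaterThanLessThan_iff less_irrefl order_le_less)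
  then have "x \<in> {-1..1} - {0}" "reaches (\<alpha> x) z"
    using x y assms by (auto simp: branch_def)
  then have "reaches x z" by (rule reaches_step)
  then show False using assms \<open>x \<in> {a<..<b}\<close> by (auto simp: avoids_def)
qed

lemma avoids_branch_neg:
  assumes "avoids z a b" "-1 \<le> a" "a < b" "b \<le> 0"
  shows "avoids z (- branch (- a)) (- branch (- b))"
  using avoids_uminus[OF avoids_branch[OF avoids_uminus[OF assms(1)]]] assms by auto

text \<open>The guaranteed growth per round: \<open>\<kappa>\<close> for an interval on one side of
  0, and \<open>\<kappa>\<^sup>2 / 2\<close> for one that is first halved at 0 and then mapped
  twice. The bound sqrt 2 on \<open>\<kappa>\<close> is what makes both exceed 1.\<close>

definition \<rho> :: real where "\<rho> = min \<kappa> (\<kappa>\<^sup>2 / 2)"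

lemma rho_gt_1: "1 < \<rho>"
proof -
  have "(sqrt 2)\<^sup>2 < \<kappa>\<^sup>2" using kappa by (intro power_strict_mono) auto
  then show ?thesis using kappa_gt_1 by (simp add: \<rho>_def)
qed

text \<open>An interval containing 0 is replaced by its larger half. If the image of that half contains 0
  again, it contains \<open>(-1, 0)\<close> up to reflection, which together with its own image covers
  \<open>(-1, 1)\<close>; otherwise the length has been multiplied by at least \<open>\<kappa>\<^sup>2 / 2 > 1\<close> after two steps.\<close>

lemma avoids_grow_aux:
  assumes "avoids z a b" "-1 \<le> a" "a < b" "b \<le> 1" "\<bar>z\<bar> < 1" "- a \<le> b"
  shows "\<exists>a' b'. -1 \<le> a' \<and> b' \<le> 1 \<and> a' < b' \<and> avoids z a' b' \<and> \<rho> * (b - a) \<le> b' - a'"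
proof (cases "0 \<le> a")
  case True
  have "\<rho> * (b - a) \<le> \<kappa> * (b - a)"
    using assms by (intro mult_right_mono) (auto simp: \<rho>_def)
  also have "\<dots> \<le> branch b - branch a"
    using True assms by (intro branch_expand) auto
  finally have "\<rho> * (b - a) \<le> branch b - branch a" .
  moreover have "branch 0 \<le> branch a" "branch b \<le> branch 1"
    using branch_mono[of 0 a] branch_mono[of b 1] True assms by auto
  ultimately show ?thesis
    using avoids_branch[OF assms(1) True assms(3,4)] branch_strict_mono[of a b] assms(3,4) True at_1
    by (intro exI[of _ "branch a"] exI[of _ "branch b"]) (simp add: branch_nonzero)
next
  case False
  then have b: "0 < b" "b \<le> 1" using assms by auto
  have av: "avoids z (-1) (\<alpha> b)"
    using avoids_branch[of z 0 b] avoids_subset[OF assms(1), of 0 b] b False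
    by (auto simp: branch_def)
  have "\<alpha> b \<le> 0"
  proof (rule ccontr)
    assume "\<not> \<alpha> b \<le> 0"
    then have av0: "avoids z (-1) 0" using avoids_subset[OF av] by auto
    then have "0 \<le> z" using avoids_not_mem[OF av0] assms by auto
    have "avoids z (- \<alpha> 1) 1"
      using avoids_branch_neg[OF av0] by (simp add: branch_def)
    then show False using avoids_not_mem[of z "- \<alpha> 1" 1] \<open>0 \<le> z\<close> assms at_1_bounds by auto
  qed
  have gt: "-1 < \<alpha> b" using alpha_pos_bounds b by auto
  have av': "avoids z (- \<alpha> 1) (- branch (- \<alpha> b))"
    using avoids_branch_neg[OF av] \<open>\<alpha> b \<le> 0\<close> gt by (auto simp: branch_def)
  have "\<rho> * (b - a) \<le> \<kappa>\<^sup>2 / 2 * (2 * b)"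
    using assms b rho_gt_1 by (intro mult_mono) (auto simp: \<rho>_def)
  also have "\<dots> = \<kappa> * (\<kappa> * (b - 0))" by (simp add: power2_eq_square)
  also have "\<dots> \<le> \<kappa> * (branch b - branch 0)"
    using b kappa_gt_1 by (intro mult_left_mono branch_expand) auto
  also have "\<dots> = \<kappa> * (1 - (- \<alpha> b))" using b by (simp add: branch_def)
  also have "\<dots> \<le> branch 1 - branch (- \<alpha> b)"
    using gt \<open>\<alpha> b \<le> 0\<close> by (intro branch_expand) auto
  finally have "\<rho> * (b - a) \<le> - branch (- \<alpha> b) - (- \<alpha> 1)" by (simp add: branch_def)
  moreover have "-1 \<le> branch (- \<alpha> b)" "branch (- \<alpha> b) < branch 1"
    using alpha_pos_bounds[of "- \<alpha> b"] branch_strict_mono[of "- \<alpha> b" 1] gt \<open>\<alpha> b \<le> 0\<close>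
    by (auto simp: branch_def)
  ultimately show ?thesis using av' at_1
    by (intro exI[of _ "- \<alpha> 1"] exI[of _ "- branch (- \<alpha> b)"]) (auto simp: branch_nonzero)
qed

text \<open>If the left half is the larger one, reflection at 0 reduces to the previous case with
  \<open>- z\<close> in place of \<open>z\<close>.\<close>

lemma avoids_grow:
  assumes "avoids z a b" "-1 \<le> a" "a < b" "b \<le> 1" "\<bar>z\<bar> < 1"
  shows "\<exists>a' b'. -1 \<le> a' \<and> b' \<le> 1 \<and> a' < b' \<and> avoids z a' b' \<and> \<rho> * (b - a) \<le> b' - a'"
proof (cases "- a \<le> b")
  case True
  then show ?thesis using avoids_grow_aux assms by blast
next
  case False
  obtain a' b' where "-1 \<le> a'" "b' \<le> 1" "a' < b'" "avoids (- z) a' b'" "\<rho> * (- a - - b) \<le> b' - a'"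
    using avoids_grow_aux[OF avoids_uminus[OF assms(1)]] assms False by auto
  then show ?thesis using avoids_uminus[of "- z" a' b']
    by (intro exI[of _ "- b'"] exI[of _ "- a'"]) (auto simp: algebra_simps)
qed

text \<open>Otherwise repeated growth yields intervals inside [-1, 1] of length at least
  \<open>\<rho> ^ n * (b - a)\<close>, which eventually exceeds 2.\<close>

lemma reaches_dense:
  assumes "-1 \<le> a" "a < b" "b \<le> 1" "\<bar>z\<bar> < 1"
  obtains x where "x \<in> {a<..<b}" "reaches x z"
proof (rule ccontr)
  assume "\<not> thesis"
  then have "avoids z a b" using that unfolding avoids_def by blast
  have "\<exists>a' b'. -1 \<le> a' \<and> b' \<le> 1 \<and> a' < b' \<and> avoids z a' b' \<and> \<rho> ^ n * (b - a) \<le> b' - a'" for n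
  proof (induction n)
    case 0
    then show ?case using assms \<open>avoids z a b\<close> by auto
  next
    case (Suc n)
    then obtain a' b' where ab: "-1 \<le> a'" "b' \<le> 1" "a' < b'" "avoids z a' b'"
      "\<rho> ^ n * (b - a) \<le> b' - a'" by blast
    obtain a'' b'' where "-1 \<le> a''" "b'' \<le> 1" "a'' < b''" "avoids z a'' b''"
      "\<rho> * (b' - a') \<le> b'' - a''" using avoids_grow[OF ab(4) ab(1) ab(3) ab(2) assms(4)] by blast
    moreover have "\<rho> ^ Suc n * (b - a) \<le> \<rho> * (b' - a')"
      using mult_left_mono[OF ab(5), of \<rho>] rho_gt_1 by (simp add: mult.assoc)
    ultimately show ?case using order_trans by blast
  qed
  moreover obtain n where "2 / (b - a) < \<rho> ^ n"
    using real_arch_pow[OF rho_gt_1] by blast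
  then have "2 < \<rho> ^ n * (b - a)" using assms by (simp add: field_simps)
  ultimately show False by (smt (verit))
qed

section \<open>Symmetric orbits of period 2 and 4, and the inverse branch\<close>

lemma period_2_point:
  obtains x where "0 < x" "x < 1" "\<alpha> x = - x" "x \<le> \<alpha> 1"
proof -
  \<comment> \<open>By oddness, a solution of \<open>\<alpha> x = - x\<close> has period 2. The
    bound \<open>x <= \<alpha> 1\<close> places its orbit in the range shared by both
    branches.\<close>
  have "continuous_on {0..1} (\<lambda>x. branch x + x)"
    by (intro continuous_intros continuous_on_branch)
  then obtain x where x: "0 \<le> x" "x \<le> 1" "branch x + x = 0"
    using IVT'[of "\<lambda>x. branch x + x" 0 0 1] at_1_bounds by (auto simp: branch_def)
  have "x \<noteq> 0" using x by auto
  then have fx: "\<alpha> x = - x" using x by (simp add: branch_def)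
  have "x \<noteq> 1" using fx at_1_bounds by auto
  have 1: "sqrt 2 * x \<le> 1 - x"
    using order_trans[OF mult_right_mono[of "sqrt 2" \<kappa> x] branch_expand[of 0 x, simplified]]
      kappa x fx \<open>x \<noteq> 0\<close> by (simp add: branch_nonzero)
  have 2: "sqrt 2 * (1 - x) \<le> \<alpha> 1 + x"
    using order_trans[OF mult_right_mono[of "sqrt 2" \<kappa> "1 - x"] branch_expand[of x 1]]
      kappa x fx \<open>x \<noteq> 0\<close> by (simp add: branch_nonzero)
  \<comment> \<open>The expansion estimates on the two sides of \<open>x\<close> combine to
    \<open>2 * x <= \<alpha> 1 + x\<close>.\<close>
  have "sqrt 2 * (sqrt 2 * x) \<le> sqrt 2 * (1 - x)"
    using 1 by (intro mult_left_mono) auto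
  then have "2 * x \<le> sqrt 2 * (1 - x)" by (simp add: mult.assoc[symmetric])
  with 2 have "x \<le> \<alpha> 1" by linarith
  with x fx \<open>x \<noteq> 0\<close> \<open>x \<noteq> 1\<close> show ?thesis by (intro that[of x]) linarith+
qed

text \<open>To the right of the zero \<open>c\<close> of \<open>branch\<close> the values lie in
  [0, 1], so the second iterate is continuous there and its sum with \<open>x\<close> changes sign.
  By oddness, \<open>\<alpha> (\<alpha> x) = - x\<close> gives period 4 with itinerary
  \<open>++--\<close>.\<close>

lemma period_4_point:
  obtains x where "0 < x" "x < 1" "0 < \<alpha> x" "\<alpha> (\<alpha> x) = - x"
proof -
  obtain c where c: "0 \<le> c" "c \<le> 1" "branch c = 0"
    using branch_IVT[of 0 1 0] at_1_bounds by (auto simp: branch_def)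
  then have "c \<noteq> 0" "c \<noteq> 1" using at_1_bounds by (auto simp: branch_def split: if_splits)
  have range: "branch ` {c..1} \<subseteq> {0..1}"
  proof safe
    fix x assume "x \<in> {c..1}"
    then have "branch c \<le> branch x" "branch x \<le> branch 1"
      using branch_mono[of c x] branch_mono[of x 1] c by auto
    then show "branch x \<in> {0..1}" using c at_1 by (simp add: branch_nonzero)
  qed
  have "continuous_on {c..1} (\<lambda>x. branch (branch x) + x)"
    by (intro continuous_intros continuous_on_compose2[OF continuous_on_branch _ range]
        continuous_on_subset[OF continuous_on_branch]) (use c in auto)
  moreover have "0 \<le> branch (branch 1) + 1"
    using alpha_pos_bounds[of "\<alpha> 1"] at_1_bounds at_1 by (simp add: branch_def)
  ultimately obtain x where x: "c \<le> x" "x \<le> 1" "branch (branch x) + x = 0"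
    using IVT'[of "\<lambda>x. branch (branch x) + x" c 0 1] c by auto
  have "x \<noteq> c" using x c \<open>c \<noteq> 1\<close> by auto
  then have "0 < branch x" using branch_strict_mono[of c x] x c by auto
  then have "0 < \<alpha> x" "\<alpha> (\<alpha> x) = - x"
    using x c \<open>c \<noteq> 0\<close> by (auto simp: branch_def split: if_splits)
  moreover have "x \<noteq> 1"
    using alpha_pos_bounds[of "\<alpha> 1"] at_1_bounds at_1 calculation(2) by auto
  ultimately show ?thesis using x c \<open>c \<noteq> 0\<close> by (intro that[of x]) linarith+
qed

text \<open>Expansion makes the inverse of the right branch 1-Lipschitz. The interval is the range
  common to both branches, and on it the left branch has the inverse
  \<open>- h (- a)\<close>.\<close>

lemma alpha_inverse:
  obtains h where "continuous_on {- \<alpha> 1..\<alpha> 1} h"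
    "\<And>a. a \<in> {- \<alpha> 1..\<alpha> 1} \<Longrightarrow> h a \<in> {0<..1} \<and> \<alpha> (h a) = a"
    "\<And>x. x \<in> {0<..1} \<Longrightarrow> \<bar>\<alpha> x\<bar> \<le> \<alpha> 1 \<Longrightarrow> h (\<alpha> x) = x"
proof -
  have "\<exists>x\<in>{0<..1}. \<alpha> x = a" if a: "a \<in> {- \<alpha> 1..\<alpha> 1}" for a
  proof -
    obtain x where "0 \<le> x" "x \<le> 1" "branch x = a"
      by (rule branch_IVT[of 0 1 a]) (use a at_1 in \<open>auto simp: branch_nonzero\<close>)
    moreover have "x \<noteq> 0" using calculation a at_1 by auto
    ultimately show ?thesis by (auto simp: branch_def intro!: bexI[of _ x])
  qed
  then obtain h where h: "\<And>a. a \<in> {- \<alpha> 1..\<alpha> 1} \<Longrightarrow> h a \<in> {0<..1} \<and> \<alpha> (h a) = a"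
    by metis
  have lip: "\<bar>x - y\<bar> \<le> \<bar>\<alpha> x - \<alpha> y\<bar>" if "x \<in> {0<..1}" "y \<in> {0<..1}" for x y
  proof -
    have *: "y - x \<le> \<alpha> y - \<alpha> x" if xy: "0 < x" "x < y" "y \<le> 1" for x y
    proof -
      have "1 * (y - x) \<le> \<kappa> * (y - x)" using kappa_gt_1 xy by (intro mult_right_mono) auto
      then show ?thesis using expand[OF xy] by (metis mult_1 order_trans)
    qed
    show ?thesis
    proof (cases x y rule: linorder_cases)
      case less
      then have "y - x \<le> \<alpha> y - \<alpha> x" using that by (intro *) auto
      then show ?thesis using less by linarith
    next
      case greater
      then have "x - y \<le> \<alpha> x - \<alpha> y" using that by (intro *) auto
      then show ?thesis using greater by linarith
    qed simp
  qed
  have "1-lipschitz_on {- \<alpha> 1..\<alpha> 1} h"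
  proof (rule lipschitz_onI)
    fix a b assume "a \<in> {- \<alpha> 1..\<alpha> 1}" "b \<in> {- \<alpha> 1..\<alpha> 1}"
    then show "dist (h a) (h b) \<le> 1 * dist a b"
      using lip[of "h a" "h b"] h[of a] h[of b] by (simp add: dist_real_def)
  qed simp
  then have "continuous_on {- \<alpha> 1..\<alpha> 1} h" by (rule lipschitz_on_continuous_on)
  moreover have "h (\<alpha> x) = x" if "x \<in> {0<..1}" "\<bar>\<alpha> x\<bar> \<le> \<alpha> 1" for x
  proof -
    have "\<alpha> x \<in> {- \<alpha> 1..\<alpha> 1}" using that by (simp add: abs_le_iff)
    then have "h (\<alpha> x) \<in> {0<..1}" "\<alpha> (h (\<alpha> x)) = \<alpha> x" using h by blast+
    then show ?thesis using lip[of "h (\<alpha> x)" x] that by simp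
  qed
  ultimately show ?thesis using h by (intro that[of h])
qed

end

section \<open>Periodic points of the Lorenz map\<close>

locale lorenz_skew_map = lorenz_interval_map +
  fixes L :: "R2 \<Rightarrow> R2" and \<beta> :: "R2 \<Rightarrow> real" and c :: real
  assumes L_eq: "x \<in> {-1..1} - {0} \<Longrightarrow> y \<in> {-1..1} \<Longrightarrow> L (x, y) = (\<alpha> x, \<beta> (x, y))"
    and beta_range: "x \<in> {-1..1} - {0} \<Longrightarrow> y \<in> {-1..1} \<Longrightarrow> \<beta> (x, y) \<in> {-1..1}"
    and contr: "x \<in> {-1..1} - {0} \<Longrightarrow> c-lipschitz_on {-1..1} (\<lambda>y. \<beta> (x, y))" "c < 1"
    and cont_pos: "continuous_on ({0<..1} \<times> {-1..1}) L"
    and cont_neg: "continuous_on ({-1..<0} \<times> {-1..1}) L"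
    and inj_pos: "inj_on L ({0<..1} \<times> {-1..1})"
    and inj_neg: "inj_on L ({-1..<0} \<times> {-1..1})"
    and disj: "L ` ({0<..1} \<times> {-1..1}) \<inter> L ` ({-1..<0} \<times> {-1..1}) = {}"
begin

section \<open>Action of the map on vertical fibres\<close>

lemma c_nonneg: "0 \<le> c"
  using contr(1)[of 1] by (auto dest: lipschitz_on_nonneg)

lemma beta_inj:
  assumes "x \<in> {-1..1} - {0}" "y \<in> {-1..1}" "y' \<in> {-1..1}" "\<beta> (x, y) = \<beta> (x, y')"
  shows "y = y'"
proof -
  have eq: "L (x, y) = L (x, y')" using assms by (simp add: L_eq)
  show ?thesis
  proof (cases "0 < x")
    case True
    then show ?thesis using inj_onD[OF inj_pos eq] assms by auto
  next
    case False
    then show ?thesis using inj_onD[OF inj_neg eq] assms by auto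
  qed
qed

text \<open>On a fibre \<open>\<beta>\<close> is continuous and injective, hence strictly monotone,
  so an interior height is sent strictly between the images of the two endpoints.\<close>

lemma beta_interior:
  assumes "x \<in> {-1..1} - {0}" "\<bar>y\<bar> < 1"
  shows "\<bar>\<beta> (x, y)\<bar> < 1"
proof -
  have "continuous_on {-1..1} (\<lambda>y. \<beta> (x, y))"
    using contr(1)[OF assms(1)] by (rule lipschitz_on_continuous_on)
  moreover have "inj_on (\<lambda>y. \<beta> (x, y)) {-1..1}"
    using beta_inj[OF assms(1)] by (auto intro: inj_onI)
  moreover have "-1 < y" "y < 1" using assms by auto
  ultimately have "\<beta> (x, -1) < \<beta> (x, y) \<and> \<beta> (x, y) < \<beta> (x, 1) \<or>
      \<beta> (x, 1) < \<beta> (x, y) \<and> \<beta> (x, y) < \<beta> (x, -1)"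
    using continuous_inj_imp_mono[of "-1" y 1 "\<lambda>y. \<beta> (x, y)"] by blast
  then show ?thesis using beta_range[OF assms(1), of 1] beta_range[OF assms(1), of "-1"] by auto
qed

lemma beta_boundaryD:
  assumes "x \<in> {-1..1} - {0}" "y \<in> {-1..1}" "\<bar>\<beta> (x, y)\<bar> = 1"
  shows "\<bar>y\<bar> = 1"
  using beta_interior[OF assms(1), of y] assms(2,3) by (cases "\<bar>y\<bar> < 1") auto

lemma continuous_on_beta:
  shows "continuous_on ({0<..1} \<times> {-1..1}) \<beta>" "continuous_on ({-1..<0} \<times> {-1..1}) \<beta>"
proof -
  show "continuous_on ({0<..1} \<times> {-1..1}) \<beta>"
    using continuous_on_snd[OF cont_pos]
    by (rule continuous_on_cong[THEN iffD1, rotated 2]) (auto simp: L_eq)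
  show "continuous_on ({-1..<0} \<times> {-1..1}) \<beta>"
    using continuous_on_snd[OF cont_neg]
    by (rule continuous_on_cong[THEN iffD1, rotated 2]) (auto simp: L_eq)
qed

text \<open>The difference of the heights of the two endpoint images never vanishes, by injectivity,
  so it has constant sign over a connected set of fibres.\<close>

lemma reversing_const:
  assumes I: "connected I" "I \<subseteq> {-1..1} - {0}" "continuous_on (I \<times> {-1..1}) \<beta>"
    and "x \<in> I" "x' \<in> I" "\<beta> (x, 1) < \<beta> (x, -1)"
  shows "\<beta> (x', 1) < \<beta> (x', -1)"
proof (rule ccontr)
  assume neg: "\<not> \<beta> (x', 1) < \<beta> (x', -1)"
  define d where "d x = \<beta> (x, 1) - \<beta> (x, -1)" for x
  have "continuous_on I d"
    unfolding d_def by (intro continuous_intros continuous_on_compose2[OF I(3)]) auto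
  then have "connected (d ` I)" using I(1) by (rule connected_continuous_image)
  moreover have "d x \<le> 0" "0 \<le> d x'" using assms neg by (auto simp: d_def)
  ultimately have "0 \<in> d ` I" using assms by (auto intro: connectedD_interval)
  then obtain u where u: "u \<in> I" "\<beta> (u, 1) = \<beta> (u, -1)" by (auto simp: d_def)
  then have "(1::real) = -1" using beta_inj[of u 1 "-1"] u subsetD[OF I(2) u(1)] by simp
  then show False by simp
qed

text \<open>The endpoints of a fibre have distinct images in [-1, 1]; if one of them lands on a
  horizontal side, the side it lands on decides the orientation.\<close>

lemma reversing_iff:
  assumes "x \<in> {-1..1} - {0}" "\<bar>s\<bar> = 1" "\<bar>\<beta> (x, s)\<bar> = 1"
  shows "\<beta> (x, 1) < \<beta> (x, -1) \<longleftrightarrow> \<beta> (x, s) = - s"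
proof -
  have "\<beta> (x, 1) \<noteq> \<beta> (x, -1)" using beta_inj[of x 1 "-1"] assms by auto
  moreover have "s = 1 \<or> s = -1" "\<beta> (x, s) = 1 \<or> \<beta> (x, s) = -1" using assms by linarith+
  ultimately show ?thesis
    using beta_range[OF assms(1), of 1] beta_range[OF assms(1), of "-1"] by auto
qed

text \<open>Over \<open>[-\<alpha> 1, \<alpha> 1]\<close> the images of the two halves of the square are disjoint bands, so one lies
  above the other; hence they cannot both touch the same horizontal side.\<close>

lemma no_crossing:
  assumes "u \<in> {0<..1}" "v \<in> {-1..<0}" "\<bar>\<alpha> u\<bar> \<le> \<alpha> 1" "\<bar>\<alpha> v\<bar> \<le> \<alpha> 1"
    and s: "s \<in> {-1..1}" "s' \<in> {-1..1}" and "\<bar>\<sigma>\<bar> = 1" "\<beta> (u, s) = \<sigma>" "\<beta> (v, s') = \<sigma>"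
  shows False
proof -
  obtain h where h: "continuous_on {- \<alpha> 1..\<alpha> 1} h"
    "\<And>a. a \<in> {- \<alpha> 1..\<alpha> 1} \<Longrightarrow> h a \<in> {0<..1} \<and> \<alpha> (h a) = a"
    "\<And>x. x \<in> {0<..1} \<Longrightarrow> \<bar>\<alpha> x\<bar> \<le> \<alpha> 1 \<Longrightarrow> h (\<alpha> x) = x"
    by (rule alpha_inverse) blast
  define J where "J = {- \<alpha> 1..\<alpha> 1}"
  define f where "f a = \<beta> (h a, s)" for a
  define g where "g a = \<beta> (- h (- a), s')" for a
  have uJ: "\<alpha> u \<in> J" and vJ: "\<alpha> v \<in> J" using assms by (auto simp: J_def abs_le_iff)
  have hr: "h a \<in> {0<..1}" "- h (- a) \<in> {-1..<0}" "\<alpha> (h a) = a" "\<alpha> (- h (- a)) = a" if "a \<in> J" for a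
    using h(2)[of a] h(2)[of "- a"] odd[of "h (- a)"] that by (auto simp: J_def)
  have fu: "f (\<alpha> u) = \<sigma>" using assms h(3)[of u] by (simp add: f_def)
  have gv: "g (\<alpha> v) = \<sigma>"
    using assms h(3)[of "- v"] odd[of v] by (auto simp: g_def)
  have neq: "f a \<noteq> g a" if "a \<in> J" for a
  proof
    assume "f a = g a"
    then have "L (h a, s) = L (- h (- a), s')"
      using hr[OF that] s by (subst (1 2) L_eq) (auto simp: f_def g_def)
    moreover have "(h a, s) \<in> {0<..1} \<times> {-1..1}" "(- h (- a), s') \<in> {-1..<0} \<times> {-1..1}"
      using hr[OF that] s by auto
    ultimately show False using disj by blast
  qed
  have range: "f a \<in> {-1..1}" "g a \<in> {-1..1}" if "a \<in> J" for a
    using hr[OF that] s unfolding f_def g_def by (intro beta_range; auto)+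
  \<comment> \<open>The curves \<open>f\<close> and \<open>g\<close> are images of horizontal lines
    in the two halves, written as graphs over the common range. At \<open>\<alpha> u\<close> the
    first, and at \<open>\<alpha> v\<close> the second, takes the extreme value
    \<open>\<sigma>\<close>, so \<open>d\<close> is nonnegative at one point and nonpositive at the
    other.\<close>
  define d where "d a = \<sigma> * (f a - g a)" for a
  have "continuous_on J f"
    unfolding f_def using h(1) hr s
    by (intro continuous_on_compose2[OF continuous_on_beta(1)] continuous_intros) (auto simp: J_def)
  moreover have "continuous_on J (\<lambda>a. h (- a))"
    by (rule continuous_on_compose2[OF h(1)]) (auto intro!: continuous_intros simp: J_def)
  then have "continuous_on J g"
    unfolding g_def using hr s
    by (intro continuous_on_compose2[OF continuous_on_beta(2)] continuous_intros) auto
  ultimately have "continuous_on J d" unfolding d_def by (intro continuous_intros)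
  then have conn: "connected (d ` J)" by (rule connected_continuous_image) (simp add: J_def)
  have sg: "\<sigma> = 1 \<or> \<sigma> = -1" using assms by linarith
  then have "0 \<le> d (\<alpha> u)" using range[OF uJ] fu by (auto simp: d_def)
  moreover have "d (\<alpha> v) \<le> 0" using sg range[OF vJ] gv by (auto simp: d_def)
  ultimately have "0 \<in> d ` J" using conn uJ vJ by (auto intro: connectedD_interval)
  then obtain a where "a \<in> J" "f a = g a" using sg by (auto simp: d_def)
  then show False using neq by blast
qed

section \<open>Fibre contraction and cycles in the interior of the square\<close>

lemma funpow_L_fibre:
  assumes "\<And>i. i < k \<Longrightarrow> (\<alpha> ^^ i) x \<in> {-1..1} - {0}" "y \<in> {-1..1}" "y' \<in> {-1..1}"
  shows "fst ((L ^^ k) (x, y)) = (\<alpha> ^^ k) x" "snd ((L ^^ k) (x, y)) \<in> {-1..1}"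
    "\<bar>snd ((L ^^ k) (x, y)) - snd ((L ^^ k) (x, y'))\<bar> \<le> c ^ k * \<bar>y - y'\<bar>"
proof -
  have *: "fst ((L ^^ k) (x, y)) = (\<alpha> ^^ k) x \<and> fst ((L ^^ k) (x, y')) = (\<alpha> ^^ k) x \<and>
    snd ((L ^^ k) (x, y)) \<in> {-1..1} \<and> snd ((L ^^ k) (x, y')) \<in> {-1..1} \<and>
    \<bar>snd ((L ^^ k) (x, y)) - snd ((L ^^ k) (x, y'))\<bar> \<le> c ^ k * \<bar>y - y'\<bar>"
    using assms
  proof (induction k)
    case (Suc k)
    then obtain z z' where z: "(L ^^ k) (x, y) = ((\<alpha> ^^ k) x, z)" "(L ^^ k) (x, y') = ((\<alpha> ^^ k) x, z')"
      "z \<in> {-1..1}" "z' \<in> {-1..1}" "\<bar>z - z'\<bar> \<le> c ^ k * \<bar>y - y'\<bar>"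
      by (metis less_SucI prod.collapse)
    have x: "(\<alpha> ^^ k) x \<in> {-1..1} - {0}" using Suc.prems by blast
    have "\<bar>\<beta> ((\<alpha> ^^ k) x, z) - \<beta> ((\<alpha> ^^ k) x, z')\<bar> \<le> c * \<bar>z - z'\<bar>"
      using lipschitz_onD[OF contr(1)[OF x] z(3,4)] by (simp add: dist_real_def)
    also have "\<dots> \<le> c * (c ^ k * \<bar>y - y'\<bar>)" using z c_nonneg by (intro mult_left_mono)
    finally show ?case
      using z L_eq[OF x z(3)] L_eq[OF x z(4)] beta_range[OF x z(3)] beta_range[OF x z(4)]
      by (simp add: mult.assoc)
  qed auto
  then show "fst ((L ^^ k) (x, y)) = (\<alpha> ^^ k) x" "snd ((L ^^ k) (x, y)) \<in> {-1..1}"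
    "\<bar>snd ((L ^^ k) (x, y)) - snd ((L ^^ k) (x, y'))\<bar> \<le> c ^ k * \<bar>y - y'\<bar>" by blast+
qed

text \<open>The \<open>k\<close>-th iterate maps the fibre over a periodic \<open>x\<close> into
  itself and contracts it by \<open>c ^ k < 1\<close>, so Banach's fixed point theorem
  applies.\<close>

lemma periodic_point_over:
  assumes "\<And>i. i < k \<Longrightarrow> (\<alpha> ^^ i) x \<in> {-1..1} - {0}" "0 < k" "(\<alpha> ^^ k) x = x"
  obtains y where "y \<in> {-1..1}" "(L ^^ k) (x, y) = (x, y)"
proof -
  have "c ^ k < 1"
    using c_nonneg contr(2) assms(2) by (simp add: power_less_one_iff)
  then have "\<exists>!y. y \<in> {-1..1} \<and> snd ((L ^^ k) (x, y)) = y"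
    using funpow_L_fibre[of k x] assms(1) c_nonneg
    by (intro Banach_fix[of "{-1..1}" "c ^ k"])
      (auto simp: dist_real_def complete_eq_closed image_subset_iff)
  then show ?thesis
    using that funpow_L_fibre(1)[of k x, OF assms(1)] assms(3) by (metis prod.collapse)
qed

text \<open>A periodic orbit is kept only as a finite forward-invariant set, which suffices for
  uniform constants. The empty set qualifies, hence the separate condition
  \<open>Q \<noteq> {}\<close> elsewhere.\<close>

definition interior_cycle :: "R2 set \<Rightarrow> bool" where
  "interior_cycle Q \<longleftrightarrow> finite Q \<and> (\<forall>q\<in>Q. \<bar>fst q\<bar> < 1 \<and> fst q \<noteq> 0 \<and> \<bar>snd q\<bar> < 1 \<and> L q \<in> Q)"

text \<open>A single interior height is enough, because \<open>beta_interior\<close> carries it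
  along the whole orbit.\<close>

lemma interior_cycleI:
  assumes x: "\<And>i. i < k \<Longrightarrow> (\<alpha> ^^ i) x \<in> {-1<..<1} - {0}" and k: "0 < k" "(L ^^ k) (x, y) = (x, y)"
    and "\<bar>y\<bar> < 1"
  shows "\<exists>Q. interior_cycle Q \<and> Q \<noteq> {}"
proof -
  have x': "(\<alpha> ^^ i) x \<in> {-1..1} - {0}" if "i < k" for i using x[OF that] by auto
  have f: "fst ((L ^^ i) (x, y)) = (\<alpha> ^^ i) x" if "i < k" for i
    using funpow_L_fibre(1)[of i x y y] x' that assms(4) by (simp add: abs_less_iff)
  have s: "\<bar>snd ((L ^^ i) (x, y))\<bar> < 1" if "i < k" for i
    using that
  proof (induction i)
    case (Suc i)
    then obtain z where z: "(L ^^ i) (x, y) = ((\<alpha> ^^ i) x, z)" "\<bar>z\<bar> < 1"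
      using f[of i] by (metis Suc_lessD prod.collapse)
    have "(\<alpha> ^^ i) x \<in> {-1..1} - {0}" using x' Suc.prems by auto
    then show ?case
      using z L_eq[of "(\<alpha> ^^ i) x" z] beta_interior[of "(\<alpha> ^^ i) x" z]
      by (simp add: abs_less_iff)
  qed (use assms(4) in auto)
  define Q where "Q = (\<lambda>i. (L ^^ i) (x, y)) ` {..<k}"
  have "L ((L ^^ i) (x, y)) \<in> Q" if "i < k" for i
  proof (cases "Suc i = k")
    case True
    then have "L ((L ^^ i) (x, y)) = (L ^^ 0) (x, y)" using k(2) by auto
    then show ?thesis using k unfolding Q_def by blast
  next
    case False
    then have "L ((L ^^ i) (x, y)) = (L ^^ Suc i) (x, y)" "Suc i < k" using that by auto
    then show ?thesis unfolding Q_def by blast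
  qed
  moreover have "\<bar>fst ((L ^^ i) (x, y))\<bar> < 1 \<and> fst ((L ^^ i) (x, y)) \<noteq> 0" if "i < k" for i
    using f[OF that] x[OF that] by (auto simp: abs_less_iff)
  ultimately have "interior_cycle Q" using s unfolding interior_cycle_def Q_def by auto
  moreover have "Q \<noteq> {}" using k by (auto simp: Q_def)
  ultimately show ?thesis by blast
qed

text \<open>If the orbit of period 2 lies on the boundary, then it must alternate between the two
  horizontal sides, so both branches reverse the vertical orientation. An orbit of period 4 with
  itinerary \<open>++--\<close> on the boundary would then contradict the ordering of the two bands.\<close>

lemma interior_cycle_exists: "\<exists>Q. interior_cycle Q \<and> Q \<noteq> {}"
proof -
  obtain x where x: "0 < x" "x < 1" "\<alpha> x = - x" "x \<le> \<alpha> 1" by (rule period_2_point)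
  have x2: "\<alpha> (- x) = x" using odd[of x] x by simp
  have it: "(\<alpha> ^^ i) x \<in> {-1<..<1} - {0}" if "i < 2" for i
    using that x by (cases i) (auto simp: less_2_cases_iff)
  have per2: "(\<alpha> ^^ 2) x = x" using x x2 by (simp add: eval_nat_numeral)
  have it': "(\<alpha> ^^ i) x \<in> {-1..1} - {0}" if "i < 2" for i using it[OF that] by simp
  obtain y where y: "y \<in> {-1..1}" "(L ^^ 2) (x, y) = (x, y)"
    by (rule periodic_point_over[OF it' zero_less_numeral per2])
  define y' where "y' = \<beta> (x, y)"
  have y': "y' \<in> {-1..1}" using beta_range[of x y] x y by (auto simp: y'_def)
  have "L (x, y) = (- x, y')" using L_eq[of x y] x y by (simp add: y'_def)
  moreover have "L (- x, y') = (x, \<beta> (- x, y'))" using L_eq[of "- x" y'] x x2 y' by simp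
  ultimately have y2: "\<beta> (- x, y') = y" using y by (simp add: numeral_2_eq_2)
  show ?thesis
  proof (cases "\<bar>y\<bar> < 1")
    case True
    then show ?thesis using interior_cycleI[of 2 x y] it y by simp
  next
    case False
    then have ay: "\<bar>y\<bar> = 1" using y by auto
    have ay': "\<bar>y'\<bar> = 1" by (rule beta_boundaryD[of "- x"]) (use x y' y2 ay in auto)
    \<comment> \<open>If the two heights agreed, the images of both halves would touch the same
      horizontal side over the common range.\<close>
    have "y' \<noteq> y"
      using no_crossing[of x "- x" y y' y] x x2 y y' y2 ay by (auto simp: y'_def)
    then have "y' = - y" using ay ay' by linarith
    then have orient: "\<beta> (x, 1) < \<beta> (x, -1)" "\<beta> (- x, 1) < \<beta> (- x, -1)"
      using reversing_iff[of x y] reversing_iff[of "- x" y'] ay ay' x y2 by (auto simp: y'_def)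
    have rev: "\<beta> (u, 1) < \<beta> (u, -1)" if "u \<in> {-1..1} - {0}" for u
    proof -
      have "{0<..1::real} \<subseteq> {-1..1} - {0}" "{-1..<0::real} \<subseteq> {-1..1} - {0}" by auto
      then show ?thesis
        using orient reversing_const[OF _ _ continuous_on_beta(1), of x u]
          reversing_const[OF _ _ continuous_on_beta(2), of "- x" u] that x
        by (cases "0 < u") auto
    qed
    have flip: "\<beta> (u, t) = - t" if "u \<in> {-1..1} - {0}" "\<bar>t\<bar> = 1" "\<bar>\<beta> (u, t)\<bar> = 1" for u t
      using reversing_iff[OF that] rev[OF that(1)] by simp
    obtain w where w: "0 < w" "w < 1" "0 < \<alpha> w" "\<alpha> (\<alpha> w) = - w" by (rule period_4_point)
    define v where "v = \<alpha> w"
    have wv: "\<alpha> w = v" by (simp add: v_def)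
    have v: "0 < v" "v < 1" "\<alpha> v = - w" "v \<le> \<alpha> 1"
      using w alpha_pos_bounds[of w] at_1 by (auto simp: v_def)
    have neg: "\<alpha> (- w) = - v" "\<alpha> (- v) = w" using odd[of w] odd[of v] w v by (auto simp: v_def)
    have it4: "(\<alpha> ^^ i) w \<in> {-1<..<1} - {0}" if "i < 4" for i
    proof -
      have "i = 0 \<or> i = 1 \<or> i = 2 \<or> i = 3" using that by linarith
      then show ?thesis
        using w(1,2) v(1-3) neg wv by (elim disjE) (simp_all add: eval_nat_numeral)
    qed
    have per4: "(\<alpha> ^^ 4) w = w" using v(3) neg wv by (simp add: eval_nat_numeral)
    have it4': "(\<alpha> ^^ i) w \<in> {-1..1} - {0}" if "i < 4" for i using it4[OF that] by simp
    obtain t where t: "t \<in> {-1..1}" "(L ^^ 4) (w, t) = (w, t)"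
      by (rule periodic_point_over[OF it4' zero_less_numeral per4])
    define t1 where "t1 = \<beta> (w, t)"
    define t2 where "t2 = \<beta> (v, t1)"
    define t3 where "t3 = \<beta> (- w, t2)"
    have t1: "t1 \<in> {-1..1}" using beta_range[of w t] w t by (auto simp: t1_def)
    have t2: "t2 \<in> {-1..1}" using beta_range[of v t1] v t1 by (auto simp: t2_def)
    have t3: "t3 \<in> {-1..1}" using beta_range[of "- w" t2] w t2 by (auto simp: t3_def)
    have "L (w, t) = (v, t1)" using L_eq[of w t] w t by (simp add: v_def t1_def)
    moreover have "L (v, t1) = (- w, t2)" using L_eq[of v t1] v t1 by (simp add: t2_def)
    moreover have "L (- w, t2) = (- v, t3)" using L_eq[of "- w" t2] w t2 neg by (simp add: t3_def)
    moreover have "L (- v, t3) = (w, \<beta> (- v, t3))" using L_eq[of "- v" t3] v t3 neg by simp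
    ultimately have t4: "\<beta> (- v, t3) = t" using t by (simp add: eval_nat_numeral)
    show ?thesis
    proof (cases "\<bar>t\<bar> < 1")
      case True
      then show ?thesis using interior_cycleI[of 4 w t] it4 t by simp
    next
      case False
      then have at: "\<bar>t\<bar> = 1" using t by auto
      have at3: "\<bar>t3\<bar> = 1" by (rule beta_boundaryD[of "- v"]) (use v t3 t4 at in auto)
      have at2: "\<bar>t2\<bar> = 1" by (rule beta_boundaryD[of "- w"]) (use w(1,2) t2 at3 in \<open>auto simp: t3_def\<close>)
      have at1: "\<bar>t1\<bar> = 1" by (rule beta_boundaryD[of v]) (use v t1 at2 in \<open>auto simp: t2_def\<close>)
      have "t1 = - t" using flip[of w t] w at at1 by (simp add: t1_def)
      moreover have "t2 = - t1" using flip[of v t1] v at1 at2 by (simp add: t2_def)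
      moreover have "t3 = - t2" using flip[of "- w" t2] w at2 at3 by (simp add: t3_def)
      \<comment> \<open>Two flips lead from \<open>t1\<close> to \<open>t3\<close>, so points over
        \<open>w\<close> and \<open>- w\<close>, in opposite halves, have images on the same
        horizontal side.\<close>
      ultimately have "t3 = t1" by linarith
      then have "\<beta> (w, t) = t1" "\<beta> (- w, t2) = t1" by (simp_all add: t1_def t3_def)
      moreover have "w \<in> {0<..1}" "- w \<in> {-1..<0}" using w(1,2) by auto
      moreover have "\<bar>\<alpha> w\<bar> \<le> \<alpha> 1" "\<bar>\<alpha> (- w)\<bar> \<le> \<alpha> 1" using v wv neg(1) by auto
      ultimately have False using no_crossing t(1) t2 at1 by blast
      then show ?thesis ..
    qed
  qed
qed

end

section \<open>Return times and time averages\<close>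

lemma dist_emb [simp]: "dist (emb p) (emb q) = dist p q"
  by (cases p; cases q) (simp add: emb_def dist_prod_def)

lemma emb_eq_iff [simp]: "emb p = emb q \<longleftrightarrow> p = q"
  by (metis dist_emb dist_eq_0_iff)

lemma continuous_on_emb [continuous_intros]:
  "continuous_on A f \<Longrightarrow> continuous_on A (\<lambda>x. emb (f x))"
proof -
  have "continuous_on UNIV emb"
    unfolding emb_def case_prod_unfold by (intro continuous_intros)
  then show "continuous_on A f \<Longrightarrow> continuous_on A (\<lambda>x. emb (f x))"
    by (rule continuous_on_compose2) auto
qed

lemma mem_Sigma_sq [simp]: "(x, y) \<in> Sigma_sq \<longleftrightarrow> x \<in> {-1..1} \<and> y \<in> {-1..1}"
  by (auto simp: Sigma_sq_def)

lemma Sigma_sq_eq: "Sigma_sq = {-1..1} \<times> {-1..1}"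
  by (auto simp: Sigma_sq_def)

lemma Sigma_minus_Gamma_eq: "Sigma_sq - Gamma_seg = ({-1..1} - {0}) \<times> {-1..1}"
  by (auto simp: Sigma_sq_def Gamma_seg_def)

lemma dist_Pair_le: "dist (a, b) (c, d) \<le> dist a c + dist b d"
  unfolding dist_Pair_Pair by (rule sqrt_sum_squares_le_sum) auto

section \<open>Time averages of eventually small or eventually large functions\<close>

lemma eventual_average_less:
  fixes h :: "real \<Rightarrow> real"
  assumes cont: "continuous_on UNIV h" and le1: "\<And>t. h t \<le> 1"
    and le: "\<And>t. T \<le> t \<Longrightarrow> h t \<le> b" and b: "0 \<le> b" "b < b'"
  shows "\<exists>t\<ge>N. 1 / t * integral {0..t} h < b'"
proof -
  define T' where "T' = max 0 T"
  \<comment> \<open>The initial segment contributes at most \<open>T'\<close>, and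
    \<open>T' + b * t < b' * t\<close> as soon as \<open>t\<close> exceeds
    \<open>T' / (b' - b)\<close>; the other summands make \<open>t\<close> positive and put it
    beyond \<open>N\<close> and \<open>T'\<close>.\<close>
  define t where "t = max N (T' / (b' - b)) + T' + 1 + \<bar>N\<bar>"
  have div: "0 \<le> T' / (b' - b)" using b by (simp add: T'_def)
  then have t: "N \<le> t" "T' \<le> t" "0 < t" "T' / (b' - b) < t"
    unfolding t_def T'_def by linarith+
  have int: "h integrable_on {c..d}" for c d
    using cont by (intro integrable_continuous_real) (auto intro: continuous_on_subset)
  have "integral {0..t} h = integral {0..T'} h + integral {T'..t} h"
    using t int by (subst Henstock_Kurzweil_Integration.integral_combine) (auto simp: T'_def)
  also have "integral {0..T'} h \<le> integral {0..T'} (\<lambda>_. 1)"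
    using le1 int by (intro integral_le) auto
  also have "integral {T'..t} h \<le> integral {T'..t} (\<lambda>_. b)"
    using le int by (intro integral_le) (auto simp: T'_def)
  finally have "integral {0..t} h \<le> T' + b * (t - T')"
    using t by (simp add: T'_def mult.commute)
  also have "\<dots> \<le> T' + b * t" using b by (simp add: T'_def algebra_simps)
  also have "\<dots> < b' * t" using t(4) b by (simp add: field_simps)
  finally have "1 / t * integral {0..t} h < b'" using t by (simp add: field_simps)
  then show ?thesis using t by blast
qed

lemma eventual_average_greater:
  fixes h :: "real \<Rightarrow> real"
  assumes cont: "continuous_on UNIV h" and ge0: "\<And>t. 0 \<le> h t"
    and ge: "\<And>t. T \<le> t \<Longrightarrow> b \<le> h t" and b: "b \<le> 1" "b' < b"
  shows "\<exists>t\<ge>N. b' < 1 / t * integral {0..t} h"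
proof -
  have "continuous_on UNIV (\<lambda>t. 1 - h t)" using cont by (intro continuous_intros)
  \<comment> \<open>The maximum with 1 keeps \<open>t\<close> positive, so that the constant 1 has
    average 1.\<close>
  then obtain t where t: "max N 1 \<le> t" "1 / t * integral {0..t} (\<lambda>t. 1 - h t) < 1 - b'"
    using eventual_average_less[of "\<lambda>t. 1 - h t" T "1 - b" "1 - b'" "max N 1"] ge0 ge b by auto
  have "h integrable_on {0..t}"
    using cont by (intro integrable_continuous_real) (auto intro: continuous_on_subset)
  then have "integral {0..t} (\<lambda>t. 1 - h t) = t - integral {0..t} h"
    using t by (subst integral_diff) auto
  then have "b' < 1 / t * integral {0..t} h" using t by (simp add: field_simps)
  then show ?thesis using t by auto
qed

section \<open>The flow as a continuous group action, and bounds on its return times\<close>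

locale geometric_lorenz_flow = lorenz_skew_map +
  fixes \<phi> :: "R3 \<times> real \<Rightarrow> R3"
  assumes flow_cont: "continuous_on UNIV \<phi>"
    and flow_0: "\<phi> (p, 0) = p"
    and flow_add: "\<phi> (\<phi> (p, s), t) = \<phi> (p, s + t)"
    and flow_origin: "\<phi> (0, t) = 0"
    and Gamma_stable: "y \<in> {-1..1} \<Longrightarrow> ((\<lambda>t. \<phi> (emb (0, y), t)) \<longlongrightarrow> 0) at_top"
    and return_L: "q \<in> Sigma_sq - Gamma_seg \<Longrightarrow> first_return \<phi> (emb ` Sigma_sq) (emb q) (emb (L q))"
begin

lemma continuous_on_flow [continuous_intros]:
  "continuous_on A f \<Longrightarrow> continuous_on A g \<Longrightarrow> continuous_on A (\<lambda>x. \<phi> (f x, g x))"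
  by (rule continuous_on_compose2[OF flow_cont]) (auto intro: continuous_intros)

lemma L_in_Sigma: "p \<in> Sigma_sq - Gamma_seg \<Longrightarrow> L p \<in> Sigma_sq"
  using return_L[of p] unfolding first_return_def by auto

lemma return_timeE:
  assumes "p \<in> Sigma_sq - Gamma_seg"
  obtains \<tau> where "0 < \<tau>" "\<phi> (emb p, \<tau>) = emb (L p)"
    "\<And>t. 0 < t \<Longrightarrow> \<phi> (emb p, t) \<in> emb ` Sigma_sq \<Longrightarrow> \<tau> \<le> t"
  using return_L[OF assms] unfolding first_return_def by force

lemma L_no_fixed_point: "p \<in> Sigma_sq - Gamma_seg \<Longrightarrow> L p \<noteq> p"
  using L_eq alpha_no_fixed_point by (auto simp: Sigma_minus_Gamma_eq)

lemma continuous_on_L: "continuous_on (Sigma_sq - Gamma_seg) L"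
proof -
  have "continuous (at q within Sigma_sq - Gamma_seg) L" if q: "q \<in> Sigma_sq - Gamma_seg" for q
  proof (cases "0 < fst q")
    case True
    have "at q within Sigma_sq - Gamma_seg = at q within {0<..1} \<times> {-1..1}"
      by (rule at_within_nhd[of q "{0<..} \<times> UNIV"])
        (use True in \<open>auto simp: Sigma_minus_Gamma_eq mem_Times_iff open_Times\<close>)
    then show ?thesis
      using cont_pos q True
      by (auto simp: continuous_on_eq_continuous_within continuous_within Sigma_minus_Gamma_eq)
  next
    case False
    then have neg: "fst q < 0" using q by (auto simp: Sigma_minus_Gamma_eq)
    have "at q within Sigma_sq - Gamma_seg = at q within {-1..<0} \<times> {-1..1}"
      by (rule at_within_nhd[of q "{..<0} \<times> UNIV"])
        (use neg in \<open>auto simp: Sigma_minus_Gamma_eq mem_Times_iff open_Times\<close>)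
    then show ?thesis
      using cont_neg q neg
      by (auto simp: continuous_on_eq_continuous_within continuous_within Sigma_minus_Gamma_eq)
  qed
  then show ?thesis by (simp add: continuous_on_eq_continuous_within)
qed

lemma near_not_Gamma:
  assumes "z \<in> Sigma_sq" "dist z q < \<bar>fst q\<bar>"
  shows "z \<in> Sigma_sq - Gamma_seg"
  using assms dist_fst_le[of z q] by (auto simp: Gamma_seg_def dist_real_def)

text \<open>After a very short return from near \<open>q\<close> the point \<open>L z\<close> would
  be close to \<open>q\<close> by continuity of the flow at time 0, and also close to
  \<open>L q\<close> by continuity of \<open>L\<close>; but \<open>L q \<noteq> q\<close>.\<close>

lemma return_time_lower_bound:
  assumes q: "q \<in> Sigma_sq - Gamma_seg"
  obtains \<delta> where "0 < \<delta>"
    "\<And>z t. z \<in> Sigma_sq \<Longrightarrow> dist z q < \<delta> \<Longrightarrow> 0 < t \<Longrightarrow> t < \<delta> \<Longrightarrow> \<phi> (emb z, t) \<notin> emb ` Sigma_sq"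
proof -
  define d where "d = dist (L q) q / 3"
  have "0 < d" using L_no_fixed_point[OF q] by (simp add: d_def)
  obtain \<delta>1 where \<delta>1: "0 < \<delta>1"
    "\<And>z. z \<in> Sigma_sq - Gamma_seg \<Longrightarrow> dist z q < \<delta>1 \<Longrightarrow> dist (L z) (L q) < d"
    using continuous_on_L q \<open>0 < d\<close> unfolding continuous_on_iff by metis
  obtain \<delta>2 where \<delta>2: "0 < \<delta>2" "\<And>w. dist w (emb q, 0) < \<delta>2 \<Longrightarrow> dist (\<phi> w) (\<phi> (emb q, 0)) < d"
    using flow_cont \<open>0 < d\<close> unfolding continuous_on_iff by (metis UNIV_I)
  define \<delta> where "\<delta> = Min {\<delta>1, \<delta>2 / 2, \<bar>fst q\<bar>}"
  have \<delta>: "\<delta> \<le> \<delta>1" "\<delta> \<le> \<delta>2 / 2" "\<delta> \<le> \<bar>fst q\<bar>" unfolding \<delta>_def by (intro Min_le; simp)+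
  have "0 < \<delta>" using \<delta>1 \<delta>2 q by (auto simp: \<delta>_def Sigma_minus_Gamma_eq)
  moreover have "\<phi> (emb z, t) \<notin> emb ` Sigma_sq"
    if z: "z \<in> Sigma_sq" "dist z q < \<delta>" and t: "0 < t" "t < \<delta>" for z t
  proof
    assume hit: "\<phi> (emb z, t) \<in> emb ` Sigma_sq"
    have z': "z \<in> Sigma_sq - Gamma_seg" using z(2) \<delta>(3) by (intro near_not_Gamma[OF z(1), of q]) linarith
    obtain \<tau> where \<tau>: "0 < \<tau>" "\<phi> (emb z, \<tau>) = emb (L z)" "\<tau> \<le> t"
      using return_timeE[OF z'] hit t(1) by metis
    have "dist (emb z, \<tau>) (emb q, 0) \<le> dist z q + \<tau>"
      using dist_Pair_le[of "emb z" \<tau> "emb q" 0] \<tau>(1) by simp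
    then have "dist (\<phi> (emb z, \<tau>)) (\<phi> (emb q, 0)) < d"
      using \<tau> t z \<delta> by (intro \<delta>2) linarith
    then have "dist (L z) q < d" by (simp add: \<tau> flow_0)
    moreover have "dist (L z) (L q) < d" using \<delta>1(2)[OF z'] z \<delta> by linarith
    moreover have "dist (L q) q \<le> dist (L z) (L q) + dist (L z) q"
      by (metis dist_triangle3)
    ultimately show False using zero_le_dist[of "L q" q] by (simp add: d_def)
  qed
  ultimately show ?thesis using that by blast
qed

text \<open>No transversality of the field to the square is assumed. Instead, near \<open>L q\<close> the square is
  not revisited within a short time, so flowing a small piece of it for small positive and negative times is
  injective, and invariance of domain shows that this sweeps out a neighbourhood of \<open>L q\<close> in
  space. Every orbit passing near \<open>L q\<close> therefore crosses the square.\<close>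

lemma return_time_upper_bound:
  assumes q: "q \<in> Sigma_sq - Gamma_seg"
    and Lq: "\<bar>fst (L q)\<bar> < 1" "fst (L q) \<noteq> 0" "\<bar>snd (L q)\<bar> < 1"
  obtains \<delta> B where "0 < \<delta>"
    "\<And>z. z \<in> Sigma_sq \<Longrightarrow> dist z q < \<delta> \<Longrightarrow> \<exists>s. 0 < s \<and> s \<le> B \<and> \<phi> (emb z, s) = emb (L z)"
proof -
  have Lq': "L q \<in> Sigma_sq - Gamma_seg"
    using L_in_Sigma[OF q] Lq by (auto simp: Gamma_seg_def)
  obtain \<epsilon> where \<epsilon>: "0 < \<epsilon>"
    "\<And>z t. z \<in> Sigma_sq \<Longrightarrow> dist z (L q) < \<epsilon> \<Longrightarrow> 0 < t \<Longrightarrow> t < \<epsilon> \<Longrightarrow> \<phi> (emb z, t) \<notin> emb ` Sigma_sq"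
    using return_time_lower_bound[OF Lq'] by blast
  obtain \<tau> where \<tau>: "0 < \<tau>" "\<phi> (emb q, \<tau>) = emb (L q)"
    using return_timeE[OF q] by metis
  define D where "D = ({-1<..<1} \<times> {-1<..<1}) \<inter> ball (L q) \<epsilon>"
  \<comment> \<open>Half of \<open>\<epsilon>\<close> keeps differences of two admissible times
    below \<open>\<epsilon>\<close>; the bound by \<open>\<tau>\<close> keeps the corrected time
    \<open>\<tau> - t\<close> below positive.\<close>
  define e where "e = min (\<epsilon> / 2) \<tau>"
  define W where "W = D \<times> {- e<..<e}"
  define \<Psi> where "\<Psi> = (\<lambda>w. \<phi> (emb (fst w), snd w))"
  have D: "z \<in> Sigma_sq" "dist z (L q) < \<epsilon>" if "z \<in> D" for z
    using that by (auto simp: D_def dist_commute)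
  have no_hit: "t' \<le> t" if "z \<in> D" "z' \<in> D" "\<bar>t\<bar> < e" "\<bar>t'\<bar> < e"
    "\<phi> (emb z, t) = \<phi> (emb z', t')" for z z' t t'
  proof (rule ccontr)
    assume "\<not> t' \<le> t"
    have "emb z = \<phi> (\<phi> (emb z', t'), - t)" using that(5) flow_add[of "emb z" t "- t"] by (simp add: flow_0)
    then have "emb z = \<phi> (emb z', t' - t)" by (simp add: flow_add)
    then have "\<phi> (emb z', t' - t) \<in> emb ` Sigma_sq" using D(1)[OF that(1)] by (metis imageI)
    moreover have "0 < t' - t" "t' - t < \<epsilon>" using \<open>\<not> t' \<le> t\<close> that(3,4) by (auto simp: e_def)
    ultimately show False using \<epsilon>(2) D[OF that(2)] by blast
  qed
  have "inj_on \<Psi> W"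
  proof (rule inj_onI)
    fix w w' assume w: "w \<in> W" "w' \<in> W" "\<Psi> w = \<Psi> w'"
    then have m: "fst w \<in> D" "fst w' \<in> D" "\<bar>snd w\<bar> < e" "\<bar>snd w'\<bar> < e"
      by (auto simp: W_def)
    then have t: "snd w = snd w'"
      using no_hit[of "fst w" "fst w'" "snd w" "snd w'"] no_hit[of "fst w'" "fst w" "snd w'" "snd w"] w(3)
      by (simp add: \<Psi>_def)
    have "\<phi> (\<Psi> w, - snd w) = \<phi> (\<Psi> w', - snd w)" by (simp add: w)
    then have "fst w = fst w'" by (simp add: \<Psi>_def flow_add flow_0 t)
    then show "w = w'" using t by (simp add: prod_eq_iff)
  qed
  moreover have "continuous_on W \<Psi>" unfolding \<Psi>_def by (intro continuous_intros)
  moreover have "open W" unfolding W_def D_def by (intro open_Times open_Int) auto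
  ultimately have "open (\<Psi> ` W)"
    using invariance_of_domain_gen[of W \<Psi>] by simp
  moreover have "emb (L q) \<in> \<Psi> ` W"
  proof
    show "emb (L q) = \<Psi> (L q, 0)" by (simp add: \<Psi>_def flow_0)
    show "(L q, 0) \<in> W"
      using Lq \<epsilon>(1) \<tau>(1) by (auto simp: W_def D_def e_def abs_less_iff mem_Times_iff)
  qed
  moreover have "continuous_on UNIV (\<lambda>z. \<phi> (emb z, \<tau>))" by (intro continuous_intros)
  ultimately have "open ((\<lambda>z. \<phi> (emb z, \<tau>)) -` (\<Psi> ` W))" "q \<in> (\<lambda>z. \<phi> (emb z, \<tau>)) -` (\<Psi> ` W)"
    using \<tau> by (auto intro: open_vimage)
  then obtain \<delta>' where \<delta>': "0 < \<delta>'" "ball q \<delta>' \<subseteq> (\<lambda>z. \<phi> (emb z, \<tau>)) -` (\<Psi> ` W)"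
    unfolding open_contains_ball by blast
  define \<delta> where "\<delta> = min \<delta>' \<bar>fst q\<bar>"
  have "\<exists>s. 0 < s \<and> s \<le> 2 * \<tau> \<and> \<phi> (emb z, s) = emb (L z)" if z: "z \<in> Sigma_sq" "dist z q < \<delta>" for z
  proof -
    have z': "z \<in> Sigma_sq - Gamma_seg" using z(2) by (intro near_not_Gamma[OF z(1), of q]) (simp add: \<delta>_def)
    have "z \<in> ball q \<delta>'" using z by (auto simp: \<delta>_def dist_commute)
    then have "\<phi> (emb z, \<tau>) \<in> \<Psi> ` W" using \<delta>'(2) by blast
    then obtain v where v: "v \<in> W" "\<phi> (emb z, \<tau>) = \<Psi> v" by blast
    define w t where "w = fst v" and "t = snd v"
    have wt: "w \<in> D" "\<bar>t\<bar> < e" "\<phi> (emb z, \<tau>) = \<phi> (emb w, t)"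
      using v by (simp_all add: w_def t_def \<Psi>_def W_def mem_Times_iff abs_less_iff)
    \<comment> \<open>Correcting \<open>\<tau>\<close> by the small time \<open>t\<close> lands
      exactly on the square, so the first return of \<open>z\<close> occurs no later than
      \<open>\<tau> - t\<close>.\<close>
    have "\<phi> (emb z, \<tau> - t) = \<phi> (\<phi> (emb w, t), - t)" using flow_add[of "emb z" \<tau> "- t"] wt by simp
    also have "\<dots> = emb w" by (simp add: flow_add flow_0)
    finally have "\<phi> (emb z, \<tau> - t) \<in> emb ` Sigma_sq" using D(1)[OF wt(1)] by simp
    moreover have "0 < \<tau> - t" "\<tau> - t \<le> 2 * \<tau>" using wt(2) by (auto simp: e_def)
    ultimately show ?thesis using return_timeE[OF z'] by (metis order_trans)
  qed
  moreover have "0 < \<delta>" using \<delta>'(1) q by (auto simp: \<delta>_def Sigma_minus_Gamma_eq)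
  ultimately show ?thesis using that by blast
qed

lemma cycle_mem_slit: "interior_cycle Q \<Longrightarrow> q \<in> Q \<Longrightarrow> q \<in> Sigma_sq - Gamma_seg"
  by (cases q) (force simp: interior_cycle_def Sigma_minus_Gamma_eq)

text \<open>The images of cycle points are again interior and off \<open>\<Gamma>\<close>, as the
  upper bound requires; finiteness of \<open>Q\<close> makes the constants uniform. The number
  \<open>\<delta>\<close> serves both as radius and as lower bound for the return time.\<close>

lemma return_time_bounds_near_cycle:
  assumes Q: "interior_cycle Q" "Q \<noteq> {}"
  obtains \<delta> B where "0 < \<delta>" "0 < B"
    "\<And>q z. q \<in> Q \<Longrightarrow> z \<in> Sigma_sq \<Longrightarrow> dist z q < \<delta> \<Longrightarrow>
      \<exists>s. \<delta> \<le> s \<and> s \<le> B \<and> \<phi> (emb z, s) = emb (L z)"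
proof -
  have "\<exists>\<delta> B. 0 < \<delta> \<and> (\<forall>z\<in>Sigma_sq. dist z q < \<delta> \<longrightarrow>
      (\<exists>s. \<delta> \<le> s \<and> s \<le> B \<and> \<phi> (emb z, s) = emb (L z)))" if q: "q \<in> Q" for q
  proof -
    have q': "q \<in> Sigma_sq - Gamma_seg" using cycle_mem_slit Q q by blast
    obtain \<delta>1 where 1: "0 < \<delta>1" "\<And>z t. z \<in> Sigma_sq \<Longrightarrow> dist z q < \<delta>1 \<Longrightarrow> 0 < t \<Longrightarrow>
        t < \<delta>1 \<Longrightarrow> \<phi> (emb z, t) \<notin> emb ` Sigma_sq"
      using return_time_lower_bound[OF q'] by blast
    have "L q \<in> Q" using Q q by (auto simp: interior_cycle_def)
    then obtain \<delta>2 B where 2: "0 < \<delta>2" "\<And>z. z \<in> Sigma_sq \<Longrightarrow> dist z q < \<delta>2 \<Longrightarrow>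
        \<exists>s. 0 < s \<and> s \<le> B \<and> \<phi> (emb z, s) = emb (L z)"
      using return_time_upper_bound[OF q'] Q(1) unfolding interior_cycle_def by metis
    define \<delta> where "\<delta> = Min {\<delta>1, \<delta>2, \<bar>fst q\<bar>}"
    have \<delta>: "\<delta> \<le> \<delta>1" "\<delta> \<le> \<delta>2" "\<delta> \<le> \<bar>fst q\<bar>" unfolding \<delta>_def by (intro Min_le; simp)+
    have "0 < \<delta>" using 1 2 q' by (auto simp: \<delta>_def Sigma_minus_Gamma_eq)
    moreover have "\<exists>s. \<delta> \<le> s \<and> s \<le> B \<and> \<phi> (emb z, s) = emb (L z)"
      if z: "z \<in> Sigma_sq" "dist z q < \<delta>" for z
    proof -
      have "z \<in> Sigma_sq - Gamma_seg" using z(2) \<delta> by (intro near_not_Gamma[OF z(1), of q]) linarith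
      then have "L z \<in> Sigma_sq" by (rule L_in_Sigma)
      obtain s where s: "0 < s" "s \<le> B" "\<phi> (emb z, s) = emb (L z)"
        using 2(2)[OF z(1)] z(2) \<delta> by fastforce
      then have "\<not> s < \<delta>1" using 1(2)[OF z(1), of s] z(2) \<delta> \<open>L z \<in> Sigma_sq\<close> by auto
      then have "\<delta> \<le> s" using \<delta> by linarith
      then show ?thesis using s by blast
    qed
    ultimately show ?thesis by blast
  qed
  then obtain \<delta> B where \<delta>B: "\<And>q. q \<in> Q \<Longrightarrow> 0 < \<delta> q"
    "\<And>q z. q \<in> Q \<Longrightarrow> z \<in> Sigma_sq \<Longrightarrow> dist z q < \<delta> q \<Longrightarrow>
      \<exists>s. \<delta> q \<le> s \<and> s \<le> B q \<and> \<phi> (emb z, s) = emb (L z)"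
    by metis
  have fin: "finite Q" using Q by (simp add: interior_cycle_def)
  define \<delta>0 where "\<delta>0 = Min (\<delta> ` Q)"
  define B0 where "B0 = max 1 (Max (B ` Q))"
  have le: "\<delta>0 \<le> \<delta> q" "B q \<le> B0" if "q \<in> Q" for q
    using fin that by (auto simp: \<delta>0_def B0_def le_max_iff_disj)
  show ?thesis
  proof
    show "0 < \<delta>0" using fin Q(2) \<delta>B(1) by (simp add: \<delta>0_def)
    show "0 < B0" by (simp add: B0_def)
    show "\<exists>s. \<delta>0 \<le> s \<and> s \<le> B0 \<and> \<phi> (emb z, s) = emb (L z)"
      if "q \<in> Q" "z \<in> Sigma_sq" "dist z q < \<delta>0" for q z
      using \<delta>B(2)[OF that(1,2)] le[OF that(1)] that(3) by (meson order_less_le_trans order_trans)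
  qed
qed

section \<open>Orbits that enter a given fibre\<close>

lemma reaches_flow:
  assumes "reaches x z" "x \<in> {-1..1}" "y \<in> {-1..1}"
  shows "\<exists>T y'. 0 \<le> T \<and> y' \<in> {-1..1} \<and> \<phi> (emb (x, y), T) = emb (z, y')"
  using assms(1) unfolding reaches_def
proof (induction rule: rtranclp_induct)
  case base
  then show ?case using assms by (intro exI[of _ 0] exI[of _ y]) (simp add: flow_0)
next
  case (step u v)
  then obtain T y' where T: "0 \<le> T" "y' \<in> {-1..1}" "\<phi> (emb (x, y), T) = emb (u, y')" by blast
  have u: "u \<in> {-1..1} - {0}" "v = \<alpha> u" using step.hyps by auto
  then have p: "(u, y') \<in> Sigma_sq - Gamma_seg" using T by (simp add: Sigma_minus_Gamma_eq)
  \<comment> \<open>Each step of \<open>\<alpha>\<close> is realised by one return of the flow,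
    whatever the height in the fibre.\<close>
  obtain \<tau> where \<tau>: "0 < \<tau>" "\<phi> (emb (u, y'), \<tau>) = emb (L (u, y'))"
    using return_timeE[OF p] by metis
  have "\<phi> (emb (x, y), T + \<tau>) = emb (v, \<beta> (u, y'))"
    using T(3) \<tau>(2) L_eq[OF u(1) T(2)] u(2) by (simp add: flow_add[symmetric])
  then show ?case using T(1) \<tau>(1) beta_range[OF u(1) T(2)]
    by (intro exI[of _ "T + \<tau>"] exI[of _ "\<beta> (u, y')"]) auto
qed

text \<open>The orbits of \<open>(fst q, y)\<close> and \<open>q\<close> share all their fibres, so
  their distance is purely vertical and contracts; 2 is the length of a fibre.\<close>

lemma shadowing_cycle:
  assumes Q: "interior_cycle Q" "q \<in> Q" and y: "y \<in> {-1..1}"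
  shows "(L ^^ k) q \<in> Q" "(L ^^ k) (fst q, y) \<in> Sigma_sq - Gamma_seg"
    "dist ((L ^^ k) (fst q, y)) ((L ^^ k) q) \<le> c ^ k * 2"
proof -
  have inQ: "(L ^^ k) q \<in> Q" for k
    using Q by (induction k) (auto simp: interior_cycle_def)
  have fst: "(\<alpha> ^^ k) (fst q) = fst ((L ^^ k) q)" for k
  proof (induction k)
    case (Suc k)
    have "(L ^^ k) q \<in> ({-1..1} - {0}) \<times> {-1..1}"
      using cycle_mem_slit[OF Q(1) inQ[of k]] unfolding Sigma_minus_Gamma_eq .
    then have "fst (L ((L ^^ k) q)) = \<alpha> (fst ((L ^^ k) q))"
      using L_eq[of "fst ((L ^^ k) q)" "snd ((L ^^ k) q)"] by (auto simp: mem_Times_iff)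
    then show ?case using Suc by simp
  qed simp
  have good: "(\<alpha> ^^ i) (fst q) \<in> {-1..1} - {0}" for i
    using cycle_mem_slit[OF Q(1) inQ[of i]] unfolding fst Sigma_minus_Gamma_eq mem_Times_iff by simp
  have sq: "snd q \<in> {-1..1}"
    using cycle_mem_slit[OF Q] unfolding Sigma_minus_Gamma_eq mem_Times_iff by simp
  note fibre = funpow_L_fibre[OF good y sq]
  show "(L ^^ k) q \<in> Q" by (rule inQ)
  show "(L ^^ k) (fst q, y) \<in> Sigma_sq - Gamma_seg"
    unfolding Sigma_minus_Gamma_eq mem_Times_iff using fibre(1,2)[of k] good[of k] by simp
  have "dist ((L ^^ k) (fst q, y)) ((L ^^ k) q) =
      \<bar>snd ((L ^^ k) (fst q, y)) - snd ((L ^^ k) (fst q, snd q))\<bar>"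
    using fibre(1)[of k] fst[of k] by (simp add: dist_prod_def dist_real_def)
  also have "\<dots> \<le> c ^ k * \<bar>y - snd q\<bar>" by (rule fibre(3))
  also have "\<dots> \<le> c ^ k * 2"
    using c_nonneg y sq by (intro mult_left_mono) auto
  finally show "dist ((L ^^ k) (fst q, y)) ((L ^^ k) q) \<le> c ^ k * 2" .
qed

lemma flow_funpow_L:
  assumes "\<And>i. i < k \<Longrightarrow> (L ^^ i) p \<in> Sigma_sq - Gamma_seg"
  shows "\<exists>T\<ge>0. \<phi> (emb p, T) = emb ((L ^^ k) p)"
  using assms
proof (induction k)
  case 0
  then show ?case by (auto simp: flow_0)
next
  case (Suc k)
  then obtain T where T: "0 \<le> T" "\<phi> (emb p, T) = emb ((L ^^ k) p)" by auto
  obtain \<tau> where \<tau>: "0 < \<tau>" "\<phi> (emb ((L ^^ k) p), \<tau>) = emb (L ((L ^^ k) p))"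
    using return_timeE[OF Suc.prems[of k]] by (metis lessI)
  then have "\<phi> (emb p, T + \<tau>) = emb ((L ^^ Suc k) p)" using T by (simp add: flow_add[symmetric])
  then show ?case using T \<tau> by (intro exI[of _ "T + \<tau>"]) auto
qed

text \<open>The test function whose averages oscillate. The radius \<open>r\<close> is chosen later
  so that it vanishes along the periodic orbit.\<close>

definition bump :: "real \<Rightarrow> R3 \<Rightarrow> real" where
  "bump r p = max 0 (1 - norm p / r)"

lemma continuous_on_bump [continuous_intros]:
  "continuous_on A f \<Longrightarrow> continuous_on A (\<lambda>x. bump r (f x))"
  unfolding bump_def divide_inverse by (intro continuous_intros)

lemma bump_bounds: "0 \<le> bump r p" "0 < r \<Longrightarrow> bump r p \<le> 1"
  by (auto simp: bump_def)

lemma bump_0 [simp]: "bump r 0 = 1"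
  by (simp add: bump_def)

text \<open>The origin is at rest, so flowing back from it would put it on the square, which lies at
  height 1.\<close>

lemma flow_nonzero: "\<phi> (emb p, t) \<noteq> 0"
proof
  assume "\<phi> (emb p, t) = 0"
  then have "emb p = 0" using flow_add[of "emb p" t "- t"] by (simp add: flow_0 flow_origin)
  then show False by (cases p) (simp add: emb_def zero_prod_def)
qed

text \<open>The flow arcs of duration \<open>B\<close> from the cycle form a compact set
  \<open>K\<close> that misses the origin, and \<open>r\<close> is at most its distance from it. By
  uniform continuity the bump is below 1/4 on arcs that start within \<open>\<eta>\<close> of the
  cycle, and orbits from the fibre over \<open>q\<close> are eventually made of such arcs.\<close>

lemma bump_small_near_cycle:
  assumes Q: "interior_cycle Q" "Q \<noteq> {}"
  obtains r x where "0 < r" "\<bar>x\<bar> < 1"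
    "\<And>y. y \<in> {-1..1} \<Longrightarrow> \<exists>T. \<forall>t\<ge>T. bump r (\<phi> (emb (x, y), t)) \<le> 1 / 4"
proof -
  obtain \<delta> B where \<delta>B: "0 < \<delta>" "0 < B"
    "\<And>q z. q \<in> Q \<Longrightarrow> z \<in> Sigma_sq \<Longrightarrow> dist z q < \<delta> \<Longrightarrow>
      \<exists>s. \<delta> \<le> s \<and> s \<le> B \<and> \<phi> (emb z, s) = emb (L z)"
    using return_time_bounds_near_cycle[OF Q] by metis
  have fin: "finite Q" using Q by (simp add: interior_cycle_def)
  define K where "K = (\<lambda>w. \<phi> (emb (fst w), snd w)) ` (Q \<times> {0..B})"
  have "compact K"
    unfolding K_def
    by (intro compact_continuous_image continuous_intros
        compact_Times[OF finite_imp_compact[OF fin] compact_Icc])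
  moreover have "0 \<notin> K" using flow_nonzero by (force simp: K_def)
  ultimately obtain r where r: "0 < r" "\<And>p. p \<in> K \<Longrightarrow> r \<le> norm p"
    using separate_point_closed[of K 0] compact_imp_closed by (auto simp: dist_norm)
  define f where "f = (\<lambda>w. bump r (\<phi> (emb (fst w), snd w)))"
  have "continuous_on (Sigma_sq \<times> {0..B}) f"
    unfolding f_def by (intro continuous_intros)
  moreover have "compact (Sigma_sq \<times> {0..B})"
    unfolding Sigma_sq_eq by (intro compact_Times) auto
  ultimately have "uniformly_continuous_on (Sigma_sq \<times> {0..B}) f"
    by (rule compact_uniformly_continuous)
  then obtain \<eta> where \<eta>: "0 < \<eta>" "\<And>w w'. w \<in> Sigma_sq \<times> {0..B} \<Longrightarrow> w' \<in> Sigma_sq \<times> {0..B} \<Longrightarrow>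
      dist w' w < \<eta> \<Longrightarrow> dist (f w') (f w) < 1 / 4"
    unfolding uniformly_continuous_on_def by (metis zero_less_divide_1_iff zero_less_numeral)
  have small: "bump r (\<phi> (emb z, s)) \<le> 1 / 4"
    if "q \<in> Q" "z \<in> Sigma_sq" "dist z q < \<eta>" "s \<in> {0..B}" for q z s
  proof -
    have "q \<in> Sigma_sq" using cycle_mem_slit[OF Q(1) that(1)] by blast
    then have "dist (f (z, s)) (f (q, s)) < 1 / 4"
      using that by (intro \<eta>(2)) (auto simp: dist_prod_def)
    moreover have "\<phi> (emb q, s) \<in> K" using that by (force simp: K_def)
    then have "f (q, s) = 0" using r by (simp add: f_def bump_def)
    ultimately show ?thesis by (simp add: f_def dist_real_def)
  qed
  obtain q where q: "q \<in> Q" using Q by blast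
  have "\<exists>T. \<forall>t\<ge>T. bump r (\<phi> (emb (fst q, y), t)) \<le> 1 / 4" if y: "y \<in> {-1..1}" for y
  proof -
    define u where "u k = (L ^^ k) (fst q, y)" for k
    note shadow = shadowing_cycle[OF Q(1) q y, folded u_def]
    have "(\<lambda>k. c ^ k * 2) \<longlonglongrightarrow> 0 * 2"
      using c_nonneg contr(2) by (intro tendsto_intros LIMSEQ_power_zero) auto
    then have "\<forall>\<^sub>F k in sequentially. c ^ k * 2 < min \<delta> \<eta>"
      using \<delta>B(1) \<eta>(1) by (intro order_tendstoD(2)) auto
    then obtain N where N: "\<And>k. N \<le> k \<Longrightarrow> c ^ k * 2 < min \<delta> \<eta>"
      unfolding eventually_sequentially by blast
    have near: "dist (u k) ((L ^^ k) q) < \<delta>" "dist (u k) ((L ^^ k) q) < \<eta>" if "N \<le> k" for k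
      using shadow(3)[of k] N[OF that] by linarith+
    have uS: "u k \<in> Sigma_sq" for k using shadow(2)[of k] by blast
    obtain T0 where T0: "\<phi> (emb (fst q, y), T0) = emb (u N)"
      using flow_funpow_L[of N "(fst q, y)"] shadow(2) unfolding u_def by blast
    \<comment> \<open>Arcs between consecutive returns are joined. Each lasts at most
      \<open>B\<close>, so smallness holds throughout it, and at least \<open>\<delta>\<close>, so
      \<open>j\<close> of them cover the times up to \<open>j * \<delta>\<close>, which are
      arbitrarily late.\<close>
    have "\<exists>T\<ge>real j * \<delta>. \<phi> (emb (u N), T) = emb (u (N + j)) \<and>
        (\<forall>t\<in>{0..T}. bump r (\<phi> (emb (u N), t)) \<le> 1 / 4)" for j
    proof (induction j)
      case 0
      have "bump r (\<phi> (emb (u N), 0)) \<le> 1 / 4"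
        using small[OF shadow(1)[of N] uS near(2), of 0] \<delta>B(2) by simp
      then show ?case by (intro exI[of _ 0]) (simp add: flow_0)
    next
      case (Suc j)
      then obtain T where T: "real j * \<delta> \<le> T" "\<phi> (emb (u N), T) = emb (u (N + j))"
        "\<And>t. t \<in> {0..T} \<Longrightarrow> bump r (\<phi> (emb (u N), t)) \<le> 1 / 4" by blast
      obtain s where s: "\<delta> \<le> s" "s \<le> B" "\<phi> (emb (u (N + j)), s) = emb (L (u (N + j)))"
        using \<delta>B(3)[OF shadow(1)[of "N + j"] uS near(1)] by auto
      have step: "\<phi> (emb (u N), T + t) = \<phi> (emb (u (N + j)), t)" for t
        using T(2) by (simp add: flow_add[symmetric])
      have "bump r (\<phi> (emb (u N), t)) \<le> 1 / 4" if "t \<in> {0..T + s}" for t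
      proof (cases "t \<le> T")
        case False
        then have "bump r (\<phi> (emb (u (N + j)), t - T)) \<le> 1 / 4"
          using that s by (intro small[OF shadow(1)[of "N + j"] uS near(2)]) auto
        then show ?thesis using step[of "t - T"] by simp
      qed (use T(3) that in auto)
      moreover have "real (Suc j) * \<delta> \<le> T + s" using T(1) s(1) by (simp add: algebra_simps)
      moreover have "\<phi> (emb (u N), T + s) = emb (u (N + Suc j))"
        using step s(3) by (simp add: u_def)
      ultimately show ?case by blast
    qed
    note long = this
    have "bump r (\<phi> (emb (fst q, y), t)) \<le> 1 / 4" if "T0 \<le> t" for t
    proof -
      obtain j where "t - T0 < real j * \<delta>" using reals_Archimedean3[OF \<delta>B(1)] by blast
      moreover obtain T where "real j * \<delta> \<le> T" "\<forall>t\<in>{0..T}. bump r (\<phi> (emb (u N), t)) \<le> 1 / 4"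
        using long[of j] by blast
      ultimately have "bump r (\<phi> (emb (u N), t - T0)) \<le> 1 / 4" using that by auto
      then show ?thesis using T0 flow_add[of "emb (fst q, y)" T0 "t - T0"] by simp
    qed
    then show ?thesis by blast
  qed
  moreover have "\<bar>fst q\<bar> < 1" using Q(1) q by (auto simp: interior_cycle_def)
  ultimately show ?thesis using that r(1) by blast
qed

section \<open>Dense sets of prescribed asymptotics and the residual set\<close>

lemma dense_fibres:
  assumes "\<bar>z\<bar> < 1" and fibre: "\<And>y. y \<in> {-1..1} \<Longrightarrow> P (emb (z, y))"
    and invariant: "\<And>p t. 0 \<le> t \<Longrightarrow> P (\<phi> (p, t)) \<Longrightarrow> P p"
  shows "Sigma_sq \<subseteq> closure {w \<in> Sigma_sq. P (emb w)}"
proof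
  fix w assume "w \<in> Sigma_sq"
  then obtain a b where w: "w = (a, b)" "a \<in> {-1..1}" "b \<in> {-1..1}" by (cases w) auto
  have "\<exists>w'\<in>{w \<in> Sigma_sq. P (emb w)}. dist w' w < e" if e: "0 < e" for e
  proof -
    \<comment> \<open>Only the first coordinate is perturbed: the orbit of \<open>(x, b)\<close>
      meets the fibre over \<open>z\<close> at any height \<open>b\<close>, and \<open>P\<close>
      passes backwards along orbits.\<close>
    obtain x where x: "x \<in> {max (-1) (a - e)<..<min 1 (a + e)}" "reaches x z"
      by (rule reaches_dense[of "max (-1) (a - e)" "min 1 (a + e)" z]) (use e w assms(1) in auto)
    then obtain T y' where "0 \<le> T" "y' \<in> {-1..1}" "\<phi> (emb (x, b), T) = emb (z, y')"
      using reaches_flow[of x z b] w by auto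
    then have "P (emb (x, b))" using invariant fibre by metis
    then show ?thesis using x w by (intro bexI[of _ "(x, b)"]) (auto simp: dist_prod_def dist_real_def)
  qed
  then show "w \<in> closure {w \<in> Sigma_sq. P (emb w)}" by (simp add: closure_approachable)
qed

lemma tail_invariant:
  assumes "0 \<le> s" "\<exists>T. \<forall>t\<ge>T. P (\<phi> (\<phi> (p, s), t))"
  shows "\<exists>T. \<forall>t\<ge>T. P (\<phi> (p, t))"
proof -
  obtain T where T: "\<And>t. T \<le> t \<Longrightarrow> P (\<phi> (p, s + t))" using assms by (auto simp: flow_add)
  have "P (\<phi> (p, t))" if "s + T \<le> t" for t using T[of "t - s"] that by simp
  then show ?thesis by blast
qed

definition average :: "(R3 \<Rightarrow> real) \<Rightarrow> R3 \<Rightarrow> real \<Rightarrow> real" where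
  "average g p t = 1 / t * integral {0..t} (\<lambda>s. g (\<phi> (p, s)))"

text \<open>For a fixed time the average is an integral over a compact interval and depends
  continuously on the initial point.\<close>

lemma open_average:
  assumes "continuous_on UNIV g"
  shows "open {w. average g (emb w) t < b}" "open {w. b < average g (emb w) t}"
proof -
  have "continuous_on UNIV (\<lambda>w. integral (cbox 0 t) (\<lambda>s. g (\<phi> (emb w, s))))"
    unfolding case_prod_unfold
    by (intro integral_continuous_on_param)
      (auto simp: case_prod_unfold intro!: continuous_intros continuous_on_compose2[OF assms])
  then have "continuous_on UNIV (\<lambda>w. average g (emb w) t)"
    unfolding average_def by (intro continuous_intros) simp
  then show "open {w. average g (emb w) t < b}" "open {w. b < average g (emb w) t}"
    by (intro open_Collect_less continuous_intros; simp)+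
qed

text \<open>A point in all \<open>Lo N\<close> and \<open>Hi N\<close> has averages below 1/3 and
  above 2/3 at arbitrarily late times. The test function is continuous on the whole space, hence on
  any \<open>M\<close>.\<close>

lemma residual_historic:
  "\<exists>H. residual_in Sigma_sq H \<and> (\<forall>p\<in>H. historic_behavior \<phi> M (emb p))"
proof -
  obtain Q where "interior_cycle Q" "Q \<noteq> {}" using interior_cycle_exists by blast
  then obtain r x where r: "0 < r" and x: "\<bar>x\<bar> < 1"
    "\<And>y. y \<in> {-1..1} \<Longrightarrow> \<exists>T. \<forall>t\<ge>T. bump r (\<phi> (emb (x, y), t)) \<le> 1 / 4"
    using bump_small_near_cycle by metis
  define g where "g = bump r"
  have g: "continuous_on UNIV g" unfolding g_def by (intro continuous_intros)
  have gt: "continuous_on UNIV (\<lambda>t. g (\<phi> (p, t)))" for p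
    unfolding g_def by (intro continuous_intros)
  \<comment> \<open>The thresholds 1/3 and 2/3 leave room for the eventual bounds 1/4 and 3/4.
    Asking for one late time makes each set a union of relatively open sets.\<close>
  define Lo where "Lo N = {w \<in> Sigma_sq. \<exists>t\<ge>real N. average g (emb w) t < 1 / 3}" for N
  define Hi where "Hi N = {w \<in> Sigma_sq. \<exists>t\<ge>real N. 2 / 3 < average g (emb w) t}" for N
  have "openin (top_of_set Sigma_sq) (Lo N)" for N
  proof -
    have "Lo N = Sigma_sq \<inter> (\<Union>t\<in>{real N..}. {w. average g (emb w) t < 1 / 3})"
      by (auto simp: Lo_def)
    then show ?thesis by (simp only:) (intro openin_open_Int open_UN ballI open_average g)
  qed
  moreover have "openin (top_of_set Sigma_sq) (Hi N)" for N
  proof -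
    have "Hi N = Sigma_sq \<inter> (\<Union>t\<in>{real N..}. {w. 2 / 3 < average g (emb w) t})"
      by (auto simp: Hi_def)
    then show ?thesis by (simp only:) (intro openin_open_Int open_UN ballI open_average g)
  qed
  moreover have "Sigma_sq \<subseteq> closure (Lo N)" for N
  proof -
    have "Sigma_sq \<subseteq> closure {w \<in> Sigma_sq. \<exists>T. \<forall>t\<ge>T. g (\<phi> (emb w, t)) \<le> 1 / 4}"
      by (rule dense_fibres[of x "\<lambda>p. \<exists>T. \<forall>t\<ge>T. g (\<phi> (p, t)) \<le> 1 / 4"])
        (use x tail_invariant[where P = "\<lambda>p. g p \<le> 1 / 4"] in \<open>simp_all add: g_def\<close>)
    also have "\<dots> \<subseteq> closure (Lo N)"
    proof (intro closure_mono subsetI)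
      fix w assume "w \<in> {w \<in> Sigma_sq. \<exists>T. \<forall>t\<ge>T. g (\<phi> (emb w, t)) \<le> 1 / 4}"
      then obtain T where "w \<in> Sigma_sq" "\<And>t. T \<le> t \<Longrightarrow> g (\<phi> (emb w, t)) \<le> 1 / 4" by blast
      moreover have "\<exists>t\<ge>real N. average g (emb w) t < 1 / 3"
        unfolding average_def
        by (rule eventual_average_less[OF gt _ calculation(2)]) (simp_all add: g_def bump_bounds r)
      ultimately show "w \<in> Lo N" unfolding Lo_def by blast
    qed
    finally show ?thesis .
  qed
  moreover have "Sigma_sq \<subseteq> closure (Hi N)" for N
  proof -
    \<comment> \<open>The fibre over 0 is \<open>\<Gamma>\<close>, whose orbits converge to the
      origin, where \<open>g\<close> is 1.\<close>
    have "\<exists>T. \<forall>t\<ge>T. 3 / 4 \<le> g (\<phi> (emb (0, y), t))" if y: "y \<in> {-1..1}" for y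
    proof -
      have "((\<lambda>t. g (\<phi> (emb (0, y), t))) \<longlongrightarrow> g 0) at_top"
        by (rule continuous_on_tendsto_compose[OF g Gamma_stable[OF y]]) auto
      then have "\<forall>\<^sub>F t in at_top. 3 / 4 < g (\<phi> (emb (0, y), t))"
        by (rule order_tendstoD(1)) (simp add: g_def)
      then show ?thesis unfolding eventually_at_top_linorder by (metis order_less_imp_le)
    qed
    then have "Sigma_sq \<subseteq> closure {w \<in> Sigma_sq. \<exists>T. \<forall>t\<ge>T. 3 / 4 \<le> g (\<phi> (emb w, t))}"
      by (intro dense_fibres[of 0 "\<lambda>p. \<exists>T. \<forall>t\<ge>T. 3 / 4 \<le> g (\<phi> (p, t))"])
        (use tail_invariant[where P = "\<lambda>p. 3 / 4 \<le> g p"] in simp_all)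
    also have "\<dots> \<subseteq> closure (Hi N)"
    proof (intro closure_mono subsetI)
      fix w assume "w \<in> {w \<in> Sigma_sq. \<exists>T. \<forall>t\<ge>T. 3 / 4 \<le> g (\<phi> (emb w, t))}"
      then obtain T where "w \<in> Sigma_sq" "\<And>t. T \<le> t \<Longrightarrow> 3 / 4 \<le> g (\<phi> (emb w, t))" by blast
      moreover have "\<exists>t\<ge>real N. 2 / 3 < average g (emb w) t"
        unfolding average_def
        by (rule eventual_average_greater[OF gt _ calculation(2)]) (simp_all add: g_def bump_bounds)
      ultimately show "w \<in> Hi N" unfolding Hi_def by blast
    qed
    finally show ?thesis .
  qed
  ultimately have "\<forall>G\<in>range Lo \<union> range Hi. openin (top_of_set Sigma_sq) G \<and> Sigma_sq \<subseteq> closure G"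
    by blast
  then have "residual_in Sigma_sq (Sigma_sq \<inter> \<Inter>(range Lo \<union> range Hi))"
    unfolding residual_in_def by (intro conjI exI[of _ "range Lo \<union> range Hi"]) simp_all
  moreover have "historic_behavior \<phi> M (emb p)" if p: "p \<in> Sigma_sq \<inter> \<Inter>(range Lo \<union> range Hi)" for p
    unfolding historic_behavior_def
  proof (intro exI conjI notI)
    show "continuous_on M g" using g continuous_on_subset by blast
    assume "\<exists>l. ((\<lambda>t. 1 / t * integral {0..t} (\<lambda>s. g (\<phi> (emb p, s)))) \<longlongrightarrow> l) at_top"
    then obtain l where l: "(average g (emb p) \<longlongrightarrow> l) at_top"
      unfolding average_def[abs_def] by blast
    \<comment> \<open>The radius 1/6 is half of the gap between the thresholds, so the two kinds of
      late averages cannot both be this close to \<open>l\<close>.\<close>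
    then obtain N where N: "\<And>t. N \<le> t \<Longrightarrow> dist (average g (emb p) t) l < 1 / 6"
      using tendstoD[OF l, of "1 / 6"] unfolding eventually_at_top_linorder by auto
    obtain n where n: "N \<le> real n" using real_arch_simple by blast
    have "p \<in> Lo n" "p \<in> Hi n" using p by blast+
    then obtain t t' where t: "real n \<le> t" "average g (emb p) t < 1 / 3"
      "real n \<le> t'" "2 / 3 < average g (emb p) t'"
      unfolding Lo_def Hi_def by blast
    then have "\<bar>average g (emb p) t - l\<bar> < 1 / 6" "\<bar>average g (emb p) t' - l\<bar> < 1 / 6"
      using N n order_trans unfolding dist_real_def by blast+
    then show False using t by linarith
  qed
  ultimately show ?thesis by blast
qed

end

section \<open>Lorenz maps as skew products\<close>

text \<open>The derivative of a C^2 extension, evaluated at the vector 1, is continuous on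
  \<open>S\<close> and restricts to a derivative of \<open>f\<close> within
  \<open>S\<close>.\<close>

lemma C2_on_derivative:
  fixes f :: "real \<Rightarrow> real"
  assumes "C2_on S f"
  obtains f' where "continuous_on S f'" "\<And>x. x \<in> S \<Longrightarrow> (f has_real_derivative f' x) (at x within S)"
proof -
  obtain U F and F' :: "real \<Rightarrow> real \<Rightarrow>\<^sub>L real" and F'' :: "real \<Rightarrow> real \<Rightarrow>\<^sub>L real \<Rightarrow>\<^sub>L real" where
    U: "S \<subseteq> U" "\<And>p. p \<in> S \<Longrightarrow> F p = f p"
    and F: "\<And>p. p \<in> U \<Longrightarrow> (F has_derivative blinfun_apply (F' p)) (at p)"
    and F': "\<And>p. p \<in> U \<Longrightarrow> (F' has_derivative blinfun_apply (F'' p)) (at p)"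
    using assms unfolding C2_on_def by blast
  have "continuous_on S F'"
    using F' U(1) by (intro continuous_at_imp_continuous_on) (blast intro: has_derivative_continuous)
  then have "continuous_on S (\<lambda>x. blinfun_apply (F' x) 1)"
    by (intro continuous_intros)
  moreover have "(f has_real_derivative blinfun_apply (F' x) 1) (at x within S)" if x: "x \<in> S" for x
  proof -
    have "(F has_derivative blinfun_apply (F' x)) (at x within S)"
      using F x U(1) by (blast intro: has_derivative_at_withinI)
    then have "(f has_derivative blinfun_apply (F' x)) (at x within S)"
      by (rule has_derivative_transform[OF x U(2)[symmetric], rotated])
    moreover have "blinfun_apply (F' x) = (*) (blinfun_apply (F' x) 1)"
      by (rule ext) (metis blinfun.scaleR_right mult.commute mult.right_neutral real_scaleR_def)
    ultimately show ?thesis unfolding has_field_derivative_def by simp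
  qed
  ultimately show ?thesis using that by blast
qed

text \<open>Since \<open>\<alpha>'\<close> is continuous on the half-open interval and blows up at 0, its infimum is attained and
  the pointwise bound by \<open>sqrt 2\<close> improves to a uniform one.\<close>

lemma uniform_expansion:
  fixes \<alpha> :: "real \<Rightarrow> real"
  assumes C2: "C2_on {0<..1} \<alpha>"
    and der: "\<And>x. x \<in> {0<..1} \<Longrightarrow> (\<alpha> has_real_derivative \<alpha>' x) (at x within {0<..1})"
    and gt: "\<And>x. x \<in> {0<..1} \<Longrightarrow> sqrt 2 < \<alpha>' x"
    and lim: "filterlim \<alpha>' at_top (at_right 0)"
  obtains \<kappa> where "sqrt 2 < \<kappa>" "\<And>x y. 0 < x \<Longrightarrow> x < y \<Longrightarrow> y \<le> 1 \<Longrightarrow> \<kappa> * (y - x) \<le> \<alpha> y - \<alpha> x"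
proof -
  obtain a' where a': "continuous_on {0<..1} a'"
    "\<And>x. x \<in> {0<..1} \<Longrightarrow> (\<alpha> has_real_derivative a' x) (at x within {0<..1})"
    using C2_on_derivative[OF C2] by blast
  \<comment> \<open>Every point of the interval, including the endpoint 1, is a limit point of it,
    so derivatives within it are unique and \<open>\<alpha>'\<close> inherits continuity.\<close>
  have eq: "a' x = \<alpha>' x" if x: "x \<in> {0<..1}" for x
  proof (rule has_field_derivative_unique)
    show "at x within {0<..1} \<noteq> bot"
    proof -
      have "{0<..1} \<noteq> {z}" for z :: real
      proof
        assume eq: "{0<..1} = {z}"
        have "(1::real) \<in> {0<..1}" "(1 / 2::real) \<in> {0<..1}" by auto
        then show False unfolding eq by simp
      qed
      then have "x islimpt {0<..1}"
        by (rule connected_imp_perfect[OF connected_Ioc x])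
      then show ?thesis by (simp add: trivial_limit_within)
    qed
  qed (use a'(2)[OF x] der[OF x] in auto)
  have cont: "continuous_on {0<..1} \<alpha>'"
    using a'(1) by (rule continuous_on_cong[THEN iffD1, rotated 2]) (auto simp: eq)
  have "\<forall>\<^sub>F x in at_right 0. 2 \<le> \<alpha>' x" using lim by (simp add: filterlim_at_top)
  then obtain b where b: "0 < b" "\<And>x. 0 < x \<Longrightarrow> x < b \<Longrightarrow> 2 \<le> \<alpha>' x"
    unfolding eventually_at_right_field by blast
  define b' where "b' = min b 1"
  have "continuous_on {b'..1} \<alpha>'"
    using b by (intro continuous_on_subset[OF cont]) (auto simp: b'_def)
  then obtain m where m: "m \<in> {b'..1}" "\<And>x. x \<in> {b'..1} \<Longrightarrow> \<alpha>' m \<le> \<alpha>' x"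
    using continuous_attains_inf[of "{b'..1}" \<alpha>'] by (auto simp: b'_def)
  \<comment> \<open>The value 2 bounds \<open>\<alpha>'\<close> from below to the left of
    \<open>b'\<close>, and the attained minimum \<open>\<alpha>' m\<close> does so on the compact
    rest.\<close>
  define \<kappa> where "\<kappa> = min 2 (\<alpha>' m)"
  have "m \<in> {0<..1}" using m(1) b(1) by (auto simp: b'_def)
  then have "sqrt 2 < \<kappa>" using gt real_sqrt_less_mono[of 2 4] by (simp add: \<kappa>_def)
  moreover have ge: "\<kappa> \<le> \<alpha>' x" if "x \<in> {0<..1}" for x
    using b(2)[of x] m(2)[of x] that by (cases "x < b'") (auto simp: \<kappa>_def b'_def)
  moreover have "\<kappa> * (y - x) \<le> \<alpha> y - \<alpha> x" if xy: "0 < x" "x < y" "y \<le> 1" for x y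
  proof -
    have "continuous_on {x..y} \<alpha>"
      using der xy by (intro continuous_on_subset[OF DERIV_continuous_on[of "{0<..1}" \<alpha> \<alpha>']]) auto
    moreover have "(\<alpha> has_real_derivative \<alpha>' z) (at z)" if "x < z" "z < y" for z
    proof -
      have "at z within {0<..1} = at z"
        using that xy by (intro at_within_interior) auto
      then show ?thesis using der[of z] that xy by simp
    qed
    ultimately obtain z where z: "x < z" "z < y" "\<alpha> y - \<alpha> x = (y - x) * \<alpha>' z"
      using MVT[OF xy(2), of \<alpha>] unfolding real_differentiable_def by (metis DERIV_unique)
    then have "\<kappa> * (y - x) \<le> \<alpha>' z * (y - x)" using ge[of z] xy by (intro mult_right_mono) auto
    then show ?thesis using z by (simp add: mult.commute)
  qed
  ultimately show ?thesis using that by blast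
qed

text \<open>The rectangle is convex, hence inside the component; conversely the first projection of
  the component is an interval that contains 1 and misses 0.\<close>

lemma Sigma_plus_eq: "Sigma_plus = {0<..1} \<times> {-1..1}"
proof
  show "{0<..1} \<times> {-1..1} \<subseteq> Sigma_plus"
    unfolding Sigma_plus_def Sigma_minus_Gamma_eq
    by (intro connected_component_maximal) (auto intro!: convex_connected convex_Times)
  have "connected Sigma_plus" by (simp add: Sigma_plus_def)
  then have conn: "connected (fst ` Sigma_plus)" by (intro connected_continuous_image continuous_intros)
  have sub: "Sigma_plus \<subseteq> ({-1..1} - {0}) \<times> {-1..1}"
    unfolding Sigma_plus_def Sigma_minus_Gamma_eq by (rule connected_component_subset)
  have "(1, 0) \<in> Sigma_plus"
    unfolding Sigma_plus_def Sigma_minus_Gamma_eq by (simp add: connected_component_refl)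
  then have one: "1 \<in> fst ` Sigma_plus" by force
  have zero: "0 \<notin> fst ` Sigma_plus" using sub by auto
  show "Sigma_plus \<subseteq> {0<..1} \<times> {-1..1}"
  proof
    fix p assume p: "p \<in> Sigma_plus"
    have "0 < fst p"
      using connectedD_interval[OF conn imageI[OF p] one, of 0] zero by (cases "fst p \<le> 0") auto
    then show "p \<in> {0<..1} \<times> {-1..1}" using sub p by (auto simp: mem_Times_iff)
  qed
qed

lemma Sigma_minus_eq: "Sigma_minus = {-1..<0} \<times> {-1..1}"
proof
  show "{-1..<0} \<times> {-1..1} \<subseteq> Sigma_minus"
    unfolding Sigma_minus_def Sigma_minus_Gamma_eq
    by (intro connected_component_maximal) (auto intro!: convex_connected convex_Times)
  have "connected Sigma_minus" by (simp add: Sigma_minus_def)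
  then have conn: "connected (fst ` Sigma_minus)" by (intro connected_continuous_image continuous_intros)
  have sub: "Sigma_minus \<subseteq> ({-1..1} - {0}) \<times> {-1..1}"
    unfolding Sigma_minus_def Sigma_minus_Gamma_eq by (rule connected_component_subset)
  have "(-1, 0) \<in> Sigma_minus"
    unfolding Sigma_minus_def Sigma_minus_Gamma_eq by (simp add: connected_component_refl)
  then have one: "-1 \<in> fst ` Sigma_minus" by force
  have zero: "0 \<notin> fst ` Sigma_minus" using sub by auto
  show "Sigma_minus \<subseteq> {-1..<0} \<times> {-1..1}"
  proof
    fix p assume p: "p \<in> Sigma_minus"
    have "fst p < 0"
      using connectedD_interval[OF conn one imageI[OF p], of 0] zero by (cases "0 \<le> fst p") auto
    then show "p \<in> {-1..<0} \<times> {-1..1}" using sub p by (auto simp: mem_Times_iff)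
  qed
qed

lemma Lorenz_map_skew:
  assumes "Lorenz_map L"
  obtains \<alpha> \<kappa> \<beta> c where "lorenz_skew_map \<alpha> \<kappa> L \<beta> c"
proof -
  have L: "C2_diffeo_on Sigma_plus L" "C2_diffeo_on Sigma_minus L" "L ` Sigma_plus \<inter> L ` Sigma_minus = {}"
    using assms unfolding Lorenz_map_def by - (elim conjE, assumption)+
  obtain \<alpha> \<alpha>' \<beta> c where
    eq: "\<forall>(x, y) \<in> Sigma_sq - Gamma_seg. L (x, y) = (\<alpha> x, \<beta> (x, y))" and
    C2: "C2_on {0<..1} \<alpha>" and
    odd: "\<forall>x \<in> {-1..1} - {0}. \<alpha> (- x) = - \<alpha> x" and
    lim: "(\<alpha> \<longlongrightarrow> -1) (at_right 0)" and
    at_1: "\<alpha> 1 < 1" and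
    der: "\<forall>x\<in>{0<..1}. (\<alpha> has_real_derivative \<alpha>' x) (at x within {0<..1}) \<and> \<alpha>' x > sqrt 2" and
    inf: "filterlim \<alpha>' at_top (at_right 0)" and
    range: "\<beta> ` (Sigma_sq - Gamma_seg) \<subseteq> {-1..1}" and
    c: "c < 1" "\<forall>x \<in> {-1..1} - {0}. c-lipschitz_on {-1..1} (\<lambda>y. \<beta> (x, y))"
    using assms unfolding Lorenz_map_def by (elim conjE exE) (rule that; assumption)
  obtain \<kappa> where \<kappa>: "sqrt 2 < \<kappa>"
    "\<And>x y. 0 < x \<Longrightarrow> x < y \<Longrightarrow> y \<le> 1 \<Longrightarrow> \<kappa> * (y - x) \<le> \<alpha> y - \<alpha> x"
    using uniform_expansion[OF C2 _ _ inf] der by metis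
  have "lorenz_skew_map \<alpha> \<kappa> L \<beta> c"
  proof
    show "continuous_on {0<..1} \<alpha>" using C2 by (rule C2_on_imp_continuous_on)
    show "continuous_on ({0<..1} \<times> {-1..1}) L" "inj_on L ({0<..1} \<times> {-1..1})"
      using L(1) unfolding C2_diffeo_on_def Sigma_plus_eq by (auto intro: C2_on_imp_continuous_on)
    show "continuous_on ({-1..<0} \<times> {-1..1}) L" "inj_on L ({-1..<0} \<times> {-1..1})"
      using L(2) unfolding C2_diffeo_on_def Sigma_minus_eq by (auto intro: C2_on_imp_continuous_on)
    show "L ` ({0<..1} \<times> {-1..1}) \<inter> L ` ({-1..<0} \<times> {-1..1}) = {}"
      using L(3) unfolding Sigma_minus_eq Sigma_plus_eq .
    show "L (x, y) = (\<alpha> x, \<beta> (x, y))" "\<beta> (x, y) \<in> {-1..1}"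
      if "x \<in> {-1..1} - {0}" "y \<in> {-1..1}" for x y
      using eq range that unfolding Sigma_minus_Gamma_eq by blast+
  qed (use \<kappa> c odd lim at_1 in blast)+
  then show ?thesis using that by blast
qed

section \<open>Passage from the vector field to a continuous flow with return map\<close>

theorem theorem2p1:
  fixes L :: "real \<times> real \<Rightarrow> real \<times> real"
    and X :: "real \<times> real \<times> real \<Rightarrow> real \<times> real \<times> real"
    and \<phi> :: "(real \<times> real \<times> real) \<times> real \<Rightarrow> real \<times> real \<times> real"
    and lam mu nu :: real
  assumes "Lorenz_map L"
    and "geometric_Lorenz_field L lam mu nu X \<phi>"
    and "\<forall>p \<in> V_region \<phi>. X p = saddle_field lam mu nu p"
  shows "\<exists>H. residual_in Sigma_sq H \<and>
             (\<forall>p\<in>H. historic_behavior \<phi> (trapping_region \<phi>) (emb p))"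
proof -
  obtain \<alpha> \<kappa> \<beta> c where "lorenz_skew_map \<alpha> \<kappa> L \<beta> c"
    using Lorenz_map_skew[OF assms(1)] .
  then interpret lorenz_skew_map \<alpha> \<kappa> L \<beta> c .
  have X: "C2_on UNIV X" "is_C2_flow X \<phi>"
    and U: "\<exists>U. open U \<and> 0 \<in> U \<and> (\<forall>p\<in>U. X p = saddle_field lam mu nu p)"
    and stable: "emb ` Gamma_seg \<subseteq> stable_manifold \<phi> 0"
    and ret: "\<forall>p \<in> Sigma_sq - Gamma_seg. first_return \<phi> (emb ` Sigma_sq) (emb p) (emb (L p))"
    using assms(2) unfolding geometric_Lorenz_field_def by blast+
  \<comment> \<open>The linear form of the field near the origin makes the origin an
    equilibrium.\<close>
  have "X 0 = 0" using U by (auto simp: saddle_field_def zero_prod_def)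
  interpret geometric_lorenz_flow \<alpha> \<kappa> L \<beta> c \<phi>
  proof
    show "continuous_on UNIV \<phi>" "\<phi> (p, 0) = p" for p
      using is_C2_flowD(1,2)[OF X(2)] by blast+
    show "\<phi> (\<phi> (p, s), t) = \<phi> (p, s + t)" for p s t
      by (rule C2_flow_add[OF X])
    show "\<phi> (0, t) = 0" for t
      by (rule C2_flow_fixed_point[OF X \<open>X 0 = 0\<close>])
    show "((\<lambda>t. \<phi> (emb (0, y), t)) \<longlongrightarrow> 0) at_top" if "y \<in> {-1..1}" for y
    proof -
      have "(0, y) \<in> Gamma_seg" using that by (auto simp: Gamma_seg_def)
      then show ?thesis using stable unfolding stable_manifold_def by blast
    qed
  qed (use ret in blast)
  show ?thesis by (rule residual_historic)
qed

end
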